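(* Let $\Gamma$ be a finite simple undirected graph with vertex set $X$, let $G=G(\Gamma)$ be the partially commutative group with commutation graph $\Gamma$, and let $L=L(\Gamma)$ be the lattice of closed subsets of $X$. Then the stabiliser $\operatorname{St}(L)$ is an arithmetic group, and it is generated by the elements of $J$, $V_\perp$ and $\operatorname{Tr}_\perp$.
   Context: Graphs and closed sets. For $Y\subseteq X$ the orthogonal complement is $Y^\perp=\{u\in X : d(u,y)\le 1 \text{ for all } y\in Y\}$, where $d$ is the graph distance in $\Gamma$ (infinite if there is no path); $\emptyset^\perp=X$, and $x^\perp=\{x\}^\perp$ for $x\in X$. The closure is $\operatorname{cl}(Y)=Y^{\perp\perp}$, and $\operatorname{cl}(x)=\operatorname{cl}(\{x\})$. $Y$ is closed if $Y=\operatorname{cl}(Y)$. $L$ is the set of all closed subsets of $X$, ordered by inclusion. Groups. $G=G(\Gamma)$ is the group with generating set $X$ and defining relations $xy=yx$ for all pairs of adjacent vertices $x,y$ of $\Gamma$. For $Y\subseteq X$, $G(Y)$ is the subgroup of $G$ generated by $Y$. Automorphisms act on the right, $g\mapsto g^\phi$. The stabiliser of $L$ is $\operatorname{St}(L)=\{\phi\in\operatorname{Aut}(G): G(Y)^\phi=G(Y)\text{ for all }Y\in L\}$. The sets $J$, $V_\perp$, $\operatorname{Tr}_\perp$. For $x,y\in X$ write $x\sim y$ if $x^\perp=y^\perp$; $[x]$ is the equivalence class of $x$. Each $[x]$ is a set of pairwise adjacent vertices, and every $\phi\in\operatorname{Aut}(G([x]))$ extends to an automorphism $\phi^{\varepsilon_x}$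 of $G$ which equals $\phi$ on $G([x])$ and fixes every element of $X\setminus[x]$. (i) $J$ is the group of automorphisms of $G$ which send each $x\in X$ to $x$ or $x^{-1}$ (independently for each $x$). (ii) $V_\perp$ is the subgroup $\prod_{[x]:\,|[x]|\ge 2}\operatorname{Aut}(G([x]))^{\varepsilon_x}$ of $\operatorname{Aut}(G)$ (an internal direct product over the equivalence classes with at least two elements). (iii) For distinct $x,y\in X$ with $x^\perp\setminus\{x\}\subseteq y^\perp$, $\operatorname{tr}_{x,y}$ is the automorphism of $G$ with $x\mapsto xy$ and $z\mapsto z$ for $z\in X\setminus\{x\}$. $\operatorname{Tr}_\perp$ is the set of those $\operatorname{tr}_{x,y}$ for which $\operatorname{cl}(y)\subsetneq\operatorname{cl}(x)$. Arithmetic groups. Two subgroups $A,B$ of a group are commensurable if $A\cap B$ has finite index in both. A linear algebraic group is $\mathbb{Q}$-defined if it is a subgroup of $\operatorname{GL}(n,\mathbb{C})$ defined by polynomials over $\mathbb{Q}$ whose group operations are morphisms defined over $\mathbb{Q}$. If $H$ is a $\mathbb{Q}$-defined linear algebraic group, a subgroup $A\subseteq H\cap\operatorname{GL}(n,\mathbb{Q})$ is an arithmetic subgroup of $H$ if it is commensurable with $H\cap\operatorname{GL}(n,\mathbb{Z})$. A group is arithmetic if it is isomorphic to an arithmetic subgroup of a $\mathbb{Q}$-defined linear algebraic group. *)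

theory Defs
  imports
    "HOL-Algebra.Bij"
    "HOL-Algebra.Coset"
    "HOL-Algebra.Generated_Groups"
    "HOL-Library.Poly_Mapping"
    "Graph_Theory.Shortest_Path"
    "Jordan_Normal_Form.Determinant"
begin

section \<open>Groups given by generators and relations\<close>

text \<open>A letter \<open>(x, True)\<close> stands for \<open>x\<close> and \<open>(x, False)\<close> for its formal inverse.\<close>

type_synonym 'a word = "('a \<times> bool) list"

definition words :: "'a set \<Rightarrow> 'a word set" where
  "words X = lists (X \<times> UNIV)"

inductive_set pres_rel :: "'a set \<Rightarrow> ('a word \<times> 'a word) set \<Rightarrow> ('a word \<times> 'a word) set"
  for X :: "'a set" and R :: "('a word \<times> 'a word) set" where
  refl: "w \<in> words X \<Longrightarrow> (w, w) \<in> pres_rel X R"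
| sym: "(v, w) \<in> pres_rel X R \<Longrightarrow> (w, v) \<in> pres_rel X R"
| trans: "(u, v) \<in> pres_rel X R \<Longrightarrow> (v, w) \<in> pres_rel X R \<Longrightarrow> (u, w) \<in> pres_rel X R"
| cancel: "u \<in> words X \<Longrightarrow> v \<in> words X \<Longrightarrow> x \<in> X \<Longrightarrow>
    (u @ [(x, b), (x, \<not> b)] @ v, u @ v) \<in> pres_rel X R"
| relation: "u \<in> words X \<Longrightarrow> v \<in> words X \<Longrightarrow> (l, r) \<in> R \<Longrightarrow> l \<in> words X \<Longrightarrow> r \<in> words X \<Longrightarrow>
    (u @ l @ v, u @ r @ v) \<in> pres_rel X R"

definition presented_group ::
    "'a set \<Rightarrow> ('a word \<times> 'a word) set \<Rightarrow> 'a word set monoid" where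
  "presented_group X R =
    \<lparr>carrier = words X // pres_rel X R,
     monoid.mult = (\<lambda>A B. \<Union>a\<in>A. \<Union>b\<in>B. pres_rel X R `` {a @ b}),
     one = pres_rel X R `` {[]}\<rparr>"

lemma words_append [simp]: "u @ v \<in> words X \<longleftrightarrow> u \<in> words X \<and> v \<in> words X"
  by (auto simp: words_def)

lemma words_Nil [simp]: "[] \<in> words X"
  by (simp add: words_def)

lemma words_Cons [simp]: "p # w \<in> words X \<longleftrightarrow> fst p \<in> X \<and> w \<in> words X"
  by (cases p) (auto simp: words_def)

lemma pres_rel_words: "(v, w) \<in> pres_rel X R \<Longrightarrow> v \<in> words X \<and> w \<in> words X"
  by (induction rule: pres_rel.induct) auto

lemma equiv_pres_rel: "equiv (words X) (pres_rel X R)"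
proof (rule equivI)
  show "pres_rel X R \<subseteq> words X \<times> words X" using pres_rel_words by fast
  show "refl_on (words X) (pres_rel X R)" by (auto simp: refl_on_def intro: pres_rel.refl)
  show "Relation.sym (pres_rel X R)" by (rule symI) (rule pres_rel.sym)
  show "Relation.trans (pres_rel X R)" by (rule transI) (rule pres_rel.trans)
qed

lemma pres_rel_context:
  assumes "(v, w) \<in> pres_rel X R" "a \<in> words X" "b \<in> words X"
  shows "(a @ v @ b, a @ w @ b) \<in> pres_rel X R"
  using assms
proof (induction rule: pres_rel.induct)
  case (cancel u v x c)
  then show ?case
    using pres_rel.cancel[of "a @ u" X "v @ b" x c R] by simp
next
  case (relation u v l r)
  then show ?case
    using pres_rel.relation[of "a @ u" X "v @ b" l r R] by simp
next
  case (trans u v w)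
  then show ?case by (blast intro: pres_rel.trans)
qed (auto intro: pres_rel.refl pres_rel.sym)

lemma pres_rel_append:
  assumes "(a, a') \<in> pres_rel X R" "(b, b') \<in> pres_rel X R"
  shows "(a @ b, a' @ b') \<in> pres_rel X R"
proof (rule pres_rel.trans)
  show "(a @ b, a' @ b) \<in> pres_rel X R"
    using pres_rel_context[OF assms(1), of "[]" b] pres_rel_words[OF assms(2)] by simp
  show "(a' @ b, a' @ b') \<in> pres_rel X R"
    using pres_rel_context[OF assms(2), of a' "[]"] pres_rel_words[OF assms(1)] by simp
qed

lemma presented_group_mult:
  assumes "a \<in> words X" "b \<in> words X"
  shows "(pres_rel X R `` {a}) \<otimes>\<^bsub>presented_group X R\<^esub> (pres_rel X R `` {b})
    = pres_rel X R `` {a @ b}"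
proof -
  have "pres_rel X R `` {a' @ b'} = pres_rel X R `` {a @ b}"
    if "(a, a') \<in> pres_rel X R" "(b, b') \<in> pres_rel X R" for a' b'
    using equiv_class_eq[OF equiv_pres_rel pres_rel_append[OF that]] by simp
  moreover have "(a, a) \<in> pres_rel X R" "(b, b) \<in> pres_rel X R"
    using assms by (auto intro: pres_rel.refl)
  ultimately have "(\<Union>a'\<in>pres_rel X R `` {a}. \<Union>b'\<in>pres_rel X R `` {b}.
      pres_rel X R `` {a' @ b'}) = pres_rel X R `` {a @ b}"
    by (blast intro!: equalityI)
  then show ?thesis
    by (simp add: presented_group_def)
qed

lemma pres_rel_inverse_word:
  assumes "w \<in> words X"
  shows "(rev (map (apsnd Not) w) @ w, []) \<in> pres_rel X R"
    and "rev (map (apsnd Not) w) \<in> words X"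
proof -
  have "(rev (map (apsnd Not) w) @ w, []) \<in> pres_rel X R
    \<and> rev (map (apsnd Not) w) \<in> words X"
    using assms
  proof (induction w)
    case (Cons p w)
    obtain x c where p: "p = (x, c)" by (cases p)
    have "(rev (map (apsnd Not) w) @ [(x, \<not> c), (x, \<not> \<not> c)] @ w,
        rev (map (apsnd Not) w) @ w) \<in> pres_rel X R"
      using Cons p by (intro pres_rel.cancel) auto
    moreover have "(rev (map (apsnd Not) w) @ w, []) \<in> pres_rel X R"
      using Cons by simp
    ultimately have "(rev (map (apsnd Not) w) @ [(x, \<not> c), (x, \<not> \<not> c)] @ w, [])
        \<in> pres_rel X R"
      by (rule pres_rel.trans)
    then show ?case
      using Cons p by simp
  qed (auto intro: pres_rel.refl)
  then show "(rev (map (apsnd Not) w) @ w, []) \<in> pres_rel X R"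
    and "rev (map (apsnd Not) w) \<in> words X" by auto
qed

lemma group_presented_group: "group (presented_group X R)"
proof -
  let ?c = "\<lambda>w. pres_rel X R `` {w}"
  have carr: "carrier (presented_group X R) = ?c ` words X"
    by (auto simp: presented_group_def quotient_def)
  have one: "\<one>\<^bsub>presented_group X R\<^esub> = ?c []"
    by (simp add: presented_group_def)
  show ?thesis
  proof (rule groupI)
    fix A assume "A \<in> carrier (presented_group X R)"
    then obtain a where a: "a \<in> words X" "A = ?c a" unfolding carr by auto
    have "?c (rev (map (apsnd Not) a)) \<otimes>\<^bsub>presented_group X R\<^esub> A = ?c []"
      using a pres_rel_inverse_word(1)[OF a(1), of R] pres_rel_inverse_word(2)[OF a(1)]
        equiv_class_eq[OF equiv_pres_rel]
      by (simp add: presented_group_mult)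
    then show "\<exists>B\<in>carrier (presented_group X R).
        B \<otimes>\<^bsub>presented_group X R\<^esub> A = \<one>\<^bsub>presented_group X R\<^esub>"
      using pres_rel_inverse_word(2)[OF a(1)] unfolding carr one by blast
  qed (auto simp: carr one presented_group_mult)
qed


section \<open>Graphs, orthogonal complements and closed sets\<close>

text \<open>With unit arc weights the library's shortest path weight is the graph distance,
  which is infinite if there is no walk from \<open>u\<close> to \<open>v\<close>.\<close>

definition graph_dist :: "('a, 'b) pre_digraph \<Rightarrow> 'a \<Rightarrow> 'a \<Rightarrow> ereal" where
  "graph_dist \<Gamma> u v = wf_digraph.\<mu> \<Gamma> (\<lambda>_. 1) u v"

definition perp :: "('a, 'b) pre_digraph \<Rightarrow> 'a set \<Rightarrow> 'a set" where
  "perp \<Gamma> Y = {u \<in> verts \<Gamma>. \<forall>y\<in>Y. graph_dist \<Gamma> u y \<le> 1}"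

definition cl :: "('a, 'b) pre_digraph \<Rightarrow> 'a set \<Rightarrow> 'a set" where
  "cl \<Gamma> Y = perp \<Gamma> (perp \<Gamma> Y)"

definition closed_sets :: "('a, 'b) pre_digraph \<Rightarrow> 'a set set" where
  "closed_sets \<Gamma> = {Y. Y \<subseteq> verts \<Gamma> \<and> Y = cl \<Gamma> Y}"

definition perp_class :: "('a, 'b) pre_digraph \<Rightarrow> 'a \<Rightarrow> 'a set" where
  "perp_class \<Gamma> x = {y \<in> verts \<Gamma>. perp \<Gamma> {x} = perp \<Gamma> {y}}"


section \<open>The partially commutative group and its automorphisms\<close>

definition pc_group :: "('a, 'b) pre_digraph \<Rightarrow> 'a word set monoid" where
  "pc_group \<Gamma> = presented_group (verts \<Gamma>)
    {([(x, True), (y, True)], [(y, True), (x, True)]) |x y. x \<rightarrow>\<^bsub>\<Gamma>\<^esub> y}"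

definition gen :: "('a, 'b) pre_digraph \<Rightarrow> 'a \<Rightarrow> 'a word set" where
  "gen \<Gamma> x = pres_rel (verts \<Gamma>)
    {([(x, True), (y, True)], [(y, True), (x, True)]) |x y. x \<rightarrow>\<^bsub>\<Gamma>\<^esub> y} `` {[(x, True)]}"

definition gen_subgroup :: "('a, 'b) pre_digraph \<Rightarrow> 'a set \<Rightarrow> 'a word set set" where
  "gen_subgroup \<Gamma> Y = generate (pc_group \<Gamma>) (gen \<Gamma> ` Y)"

text \<open>\<^const>\<open>AutoGroup\<close> composes maps as functions written on the left. Writing
  automorphisms on the right gives the opposite group, which has the same subgroups and the
  same generating sets, and each of whose subgroups is isomorphic via inversion to the
  corresponding subgroup of \<^const>\<open>AutoGroup\<close>.\<close>

abbreviation Aut_pc :: "('a, 'b) pre_digraph \<Rightarrow> ('a word set \<Rightarrow> 'a word set) monoid" where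
  "Aut_pc \<Gamma> \<equiv> AutoGroup (pc_group \<Gamma>)"

definition St :: "('a, 'b) pre_digraph \<Rightarrow> ('a word set \<Rightarrow> 'a word set) set" where
  "St \<Gamma> = {\<phi> \<in> auto (pc_group \<Gamma>).
    \<forall>Y\<in>closed_sets \<Gamma>. \<phi> ` gen_subgroup \<Gamma> Y = gen_subgroup \<Gamma> Y}"

definition J_auts :: "('a, 'b) pre_digraph \<Rightarrow> ('a word set \<Rightarrow> 'a word set) set" where
  "J_auts \<Gamma> = {\<phi> \<in> auto (pc_group \<Gamma>).
    \<forall>x\<in>verts \<Gamma>. \<phi> (gen \<Gamma> x) \<in> {gen \<Gamma> x, inv\<^bsub>pc_group \<Gamma>\<^esub> gen \<Gamma> x}}"

text \<open>\<open>class_auts \<Gamma> x\<close> is the image of \<open>Aut(G([x]))\<close> under the extension map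
  \<open>\<epsilon>\<^sub>x\<close>: all extensions \<open>\<phi>\<close> of automorphisms \<open>\<psi>\<close> of \<open>G([x])\<close> by the identity on the
  remaining generators.\<close>

definition class_auts ::
    "('a, 'b) pre_digraph \<Rightarrow> 'a \<Rightarrow> ('a word set \<Rightarrow> 'a word set) set" where
  "class_auts \<Gamma> x = {\<phi> \<in> auto (pc_group \<Gamma>).
    (\<exists>\<psi>\<in>auto (pc_group \<Gamma>\<lparr>carrier := gen_subgroup \<Gamma> (perp_class \<Gamma> x)\<rparr>).
       \<forall>g\<in>gen_subgroup \<Gamma> (perp_class \<Gamma> x). \<phi> g = \<psi> g) \<and>
    (\<forall>z\<in>verts \<Gamma> - perp_class \<Gamma> x. \<phi> (gen \<Gamma> z) = gen \<Gamma> z)}"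

text \<open>The internal direct product of the subgroups \<^const>\<open>class_auts\<close> is the
  subgroup which they generate.\<close>

definition V_perp :: "('a, 'b) pre_digraph \<Rightarrow> ('a word set \<Rightarrow> 'a word set) set" where
  "V_perp \<Gamma> = generate (Aut_pc \<Gamma>)
    (\<Union>x\<in>{x \<in> verts \<Gamma>. card (perp_class \<Gamma> x) \<ge> 2}. class_auts \<Gamma> x)"

text \<open>\<open>is_tr \<Gamma> x y \<phi>\<close> says that \<open>\<phi>\<close> is the automorphism \<open>tr\<^sub>x\<^sub>,\<^sub>y\<close>; its values on the
  generators determine it.\<close>

definition is_tr ::
    "('a, 'b) pre_digraph \<Rightarrow> 'a \<Rightarrow> 'a \<Rightarrow> ('a word set \<Rightarrow> 'a word set) \<Rightarrow> bool" where
  "is_tr \<Gamma> x y \<phi> \<longleftrightarrow>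
    x \<in> verts \<Gamma> \<and> y \<in> verts \<Gamma> \<and> x \<noteq> y \<and> perp \<Gamma> {x} - {x} \<subseteq> perp \<Gamma> {y} \<and>
    \<phi> \<in> auto (pc_group \<Gamma>) \<and>
    \<phi> (gen \<Gamma> x) = gen \<Gamma> x \<otimes>\<^bsub>pc_group \<Gamma>\<^esub> gen \<Gamma> y \<and>
    (\<forall>z\<in>verts \<Gamma> - {x}. \<phi> (gen \<Gamma> z) = gen \<Gamma> z)"

definition Tr_perp :: "('a, 'b) pre_digraph \<Rightarrow> ('a word set \<Rightarrow> 'a word set) set" where
  "Tr_perp \<Gamma> = {\<phi>. \<exists>x y. is_tr \<Gamma> x y \<phi> \<and> cl \<Gamma> {y} \<subset> cl \<Gamma> {x}}"


section \<open>Arithmetic groups\<close>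

text \<open>Polynomials with rational coefficients in variables of type \<open>'v\<close>: finitely supported
  maps from monomials to coefficients, a monomial being a finitely supported map from variables
  to exponents.\<close>

type_synonym 'v qpoly = "('v \<Rightarrow>\<^sub>0 nat) \<Rightarrow>\<^sub>0 rat"

definition qpoly_vars :: "'v qpoly \<Rightarrow> 'v set" where
  "qpoly_vars p = (\<Union>m\<in>Poly_Mapping.keys p. Poly_Mapping.keys m)"

definition qpoly_eval :: "('v \<Rightarrow> complex) \<Rightarrow> 'v qpoly \<Rightarrow> complex" where
  "qpoly_eval a p = (\<Sum>m\<in>Poly_Mapping.keys p. of_rat (Poly_Mapping.lookup p m) *
    (\<Prod>v\<in>Poly_Mapping.keys m. a v ^ Poly_Mapping.lookup m v))"

definition GL :: "nat \<Rightarrow> complex mat monoid" where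
  "GL n = units_of (ring_mat TYPE(complex) n ())"

definition GL_rat :: "nat \<Rightarrow> complex mat set" where
  "GL_rat n = map_mat of_rat ` Units (ring_mat TYPE(rat) n ())"

definition GL_int :: "nat \<Rightarrow> complex mat set" where
  "GL_int n = map_mat of_int ` Units (ring_mat TYPE(int) n ())"

text \<open>The coordinates on the affine variety \<open>GL(n, \<complex>)\<close> are the matrix entries (\<open>Some (i, j)\<close>)
  and the inverse of the determinant (\<open>None\<close>). A map between closed subvarieties is a morphism
  over the rationals if its coordinates are polynomials over the rationals in the
  coordinates of its argument.\<close>

definition coords :: "nat \<Rightarrow> (nat \<times> nat) option set" where
  "coords n = insert None (Some ` ({..<n} \<times> {..<n}))"

fun mat_coord :: "complex mat \<Rightarrow> (nat \<times> nat) option \<Rightarrow> complex" where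
  "mat_coord A None = 1 / det A"
| "mat_coord A (Some (i, j)) = A $$ (i, j)"

definition Q_morphism ::
    "'v set \<Rightarrow> ('s \<Rightarrow> 'v \<Rightarrow> complex) \<Rightarrow> 's set \<Rightarrow> nat \<Rightarrow> ('s \<Rightarrow> complex mat) \<Rightarrow> bool" where
  "Q_morphism V c S n f \<longleftrightarrow> (\<forall>k\<in>coords n. \<exists>p. qpoly_vars p \<subseteq> V \<and>
    (\<forall>s\<in>S. mat_coord (f s) k = qpoly_eval (c s) p))"

definition Q_defined_group :: "nat \<Rightarrow> complex mat set \<Rightarrow> bool" where
  "Q_defined_group n H \<longleftrightarrow>
    subgroup H (GL n) \<and>
    (\<exists>P :: (nat \<times> nat) qpoly set.
       (\<forall>p\<in>P. qpoly_vars p \<subseteq> {..<n} \<times> {..<n}) \<and>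
       H = {A \<in> carrier (GL n). \<forall>p\<in>P. qpoly_eval (\<lambda>ij. A $$ ij) p = 0}) \<and>
    Q_morphism (coords n <+> coords n) (\<lambda>(A, B). case_sum (mat_coord A) (mat_coord B))
      (H \<times> H) n (\<lambda>(A, B). A \<otimes>\<^bsub>GL n\<^esub> B) \<and>
    Q_morphism (coords n) mat_coord H n (\<lambda>A. inv\<^bsub>GL n\<^esub> A)"

definition finite_index :: "('g, 'm) monoid_scheme \<Rightarrow> 'g set \<Rightarrow> 'g set \<Rightarrow> bool" where
  "finite_index K A B \<longleftrightarrow> finite (rcosets\<^bsub>K\<lparr>carrier := A\<rparr>\<^esub> B)"

definition commensurable :: "('g, 'm) monoid_scheme \<Rightarrow> 'g set \<Rightarrow> 'g set \<Rightarrow> bool" where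
  "commensurable K A B \<longleftrightarrow> subgroup A K \<and> subgroup B K \<and>
    finite_index K A (A \<inter> B) \<and> finite_index K B (A \<inter> B)"

definition arithmetic_subgroup :: "nat \<Rightarrow> complex mat set \<Rightarrow> complex mat set \<Rightarrow> bool" where
  "arithmetic_subgroup n H A \<longleftrightarrow>
    subgroup A (GL n) \<and> A \<subseteq> H \<inter> GL_rat n \<and> commensurable (GL n) A (H \<inter> GL_int n)"

definition arithmetic_group :: "('g, 'm) monoid_scheme \<Rightarrow> bool" where
  "arithmetic_group G \<longleftrightarrow> group G \<and>
    (\<exists>n H A. Q_defined_group n H \<and> arithmetic_subgroup n H A \<and>
       G \<cong> (GL n\<lparr>carrier := A\<rparr>))"

end

theory Submission
  imports Defs "HOL-Algebra.Elementary_Groups"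
begin

text \<open>
  For a vertex \<open>x\<close> the closure \<open>cl(x)\<close> is a clique, so \<open>G(cl(x))\<close> is free abelian on \<open>cl(x)\<close>, and
  \<open>y \<in> cl(x)\<close> is a preorder. An automorphism \<open>\<phi>\<close> in \<open>St(L)\<close> maps \<open>x\<close> into \<open>G(cl(x))\<close> and is therefore
  determined by the integer matrix whose \<open>(y, x)\<close>-entry is the exponent of \<open>y\<close> in \<open>\<phi>(x)\<close>.
  This identifies \<open>St(L)\<close> with the group of units of the integral incidence algebra of the
  preorder, that is, with \<open>H \<inter> GL(n, \<int>)\<close>, where \<open>H\<close> is the group of invertible complex matrices
  whose \<open>(y, x)\<close>-entry vanishes unless \<open>y \<in> cl(x)\<close>.

  Such an integral matrix is a product \<open>D U\<close>, where \<open>D\<close> consists of the diagonal blocks belonging to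
  the equivalence classes \<open>[x]\<close> and \<open>U\<close> is unipotent. The blocks of \<open>D\<close> lie in \<open>J\<close> or \<open>V\<^sub>\<perp>\<close>, and \<open>U\<close>
  is a product of elementary matrices, which are powers of elements of \<open>Tr\<^sub>\<perp>\<close>.
\<close>

section \<open>Homomorphisms out of presented groups\<close>

text \<open>\<open>G\<close> is not abelian, so matrices describe its endomorphisms only because of
  two facts. The exponent sum of a vertex is a homomorphism from all of \<open>G\<close> to the
  integers; hence composition becomes the matrix product without any commutation. And if x and x'
  are equal or adjacent, then so are any y in cl(x) and y' in cl(x'); hence columns supported on the
  sets cl(x) can be chosen freely and still respect the defining relations.

  The splitting D U rests on the convexity of the classes: a vertex between two equivalent vertices
  is equivalent to them. Taking diagonal blocks is therefore multiplicative, the blocks of the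
  inverse matrix invert D, and U, the product of D^-1 with the given matrix, has identity blocks on
  its diagonal.

  The obstacle on the arithmetic side is that the inverse must have the zero pattern too, or it
  defines no inverse endomorphism. Membership in H and in GL(n, Z) does not include this; it is
  derived by linear algebra over a field.\<close>

fun eval_word :: "('g, 'm) monoid_scheme \<Rightarrow> ('a \<Rightarrow> 'g) \<Rightarrow> 'a word \<Rightarrow> 'g" where
  "eval_word K f [] = \<one>\<^bsub>K\<^esub>"
| "eval_word K f ((x, b) # w) = (if b then f x else inv\<^bsub>K\<^esub> f x) \<otimes>\<^bsub>K\<^esub> eval_word K f w"

lemma (in group) eval_word_closed:
  "f \<in> X \<rightarrow> carrier G \<Longrightarrow> w \<in> words X \<Longrightarrow> eval_word G f w \<in> carrier G"
  by (induction w) (auto simp: Pi_iff)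

lemma (in group) eval_word_append:
  assumes "f \<in> X \<rightarrow> carrier G" "v \<in> words X" "w \<in> words X"
  shows "eval_word G f (v @ w) = eval_word G f v \<otimes> eval_word G f w"
  using assms(2)
proof (induction v)
  case Nil
  then show ?case using eval_word_closed[OF assms(1,3)] by simp
next
  case (Cons p v)
  obtain x b where "p = (x, b)" by (cases p)
  then show ?case
    using Cons assms(1) eval_word_closed[OF assms(1)] assms(3) by (auto simp: m_assoc Pi_iff)
qed

lemma (in group) eval_word_pres_rel:
  assumes f: "f \<in> X \<rightarrow> carrier G"
    and R: "\<And>l r. (l, r) \<in> R \<Longrightarrow> eval_word G f l = eval_word G f r"
    and "(v, w) \<in> pres_rel X R"
  shows "eval_word G f v = eval_word G f w"
  using assms(3)
proof (induction rule: pres_rel.induct)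
  case (cancel u v x b)
  then have "f x \<in> carrier G" using f by auto
  then have "f x \<otimes> (inv f x \<otimes> a) = a" "inv f x \<otimes> (f x \<otimes> a) = a" if "a \<in> carrier G" for a
    using that by (simp_all add: m_assoc[symmetric])
  with cancel show ?case
    using eval_word_closed[OF f] by (simp add: eval_word_append[OF f])
next
  case (relation u v l r)
  then show ?case by (simp add: eval_word_append[OF f] R[OF relation.hyps(3)])
next
  case (trans u v w)
  then show ?case by simp
qed simp_all

lemma image_singletonI: "(\<And>v. v \<in> A \<Longrightarrow> f v = y) \<Longrightarrow> w \<in> A \<Longrightarrow> f ` A = {y}"
  by auto

lemma presented_group_hom_exists:
  assumes K: "group K" and f: "f \<in> X \<rightarrow> carrier K"
    and R: "\<And>l r. (l, r) \<in> R \<Longrightarrow> eval_word K f l = eval_word K f r"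
  shows "\<exists>h\<in>hom (presented_group X R) K. \<forall>x\<in>X. h (pres_rel X R `` {[(x, True)]}) = f x"
proof -
  interpret K: group K by (rule K)
  let ?c = "\<lambda>w. pres_rel X R `` {w}"
  \<comment> \<open>\<open>eval_word\<close> is constant on a class, so the image of a class is a
    singleton and \<open>the_elem\<close> reads off its value without choosing a
    representative.\<close>
  define h where "h A = the_elem (eval_word K f ` A)" for A
  have h: "h (?c w) = eval_word K f w" if "w \<in> words X" for w
  proof -
    have "eval_word K f v = eval_word K f w" if "v \<in> ?c w" for v
      using K.eval_word_pres_rel[where R = R, OF f R, of w v] that by simp
    moreover have "w \<in> ?c w" using pres_rel.refl[OF that] by simp
    ultimately have "eval_word K f ` ?c w = {eval_word K f w}" by (rule image_singletonI)
    then show ?thesis by (simp add: h_def)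
  qed
  have carr: "carrier (presented_group X R) = ?c ` words X"
    by (auto simp: presented_group_def quotient_def)
  have "h \<in> hom (presented_group X R) K"
    by (rule homI)
      (auto simp: carr h presented_group_mult K.eval_word_append[OF f] K.eval_word_closed[OF f])
  moreover have "h (?c [(x, True)]) = f x" if "x \<in> X" for x
    using that f h[of "[(x, True)]"] by (auto simp: Pi_iff)
  ultimately show ?thesis by blast
qed

lemma presented_group_generated:
  "generate (presented_group X R) ((\<lambda>x. pres_rel X R `` {[(x, True)]}) ` X)
    = carrier (presented_group X R)" (is "generate ?G ?S = _")
proof -
  interpret group ?G by (rule group_presented_group)
  let ?c = "\<lambda>w. pres_rel X R `` {w}"
  have carr: "carrier ?G = ?c ` words X"
    by (auto simp: presented_group_def quotient_def)
  have S: "?S \<subseteq> carrier ?G" by (auto simp: carr)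
  have "?c w \<in> generate ?G ?S" if "w \<in> words X" for w
    using that
  proof (induction w)
    case Nil
    have "?c [] = \<one>\<^bsub>?G\<^esub>" by (simp add: presented_group_def)
    then show ?case by (metis generate.one)
  next
    case (Cons p w)
    obtain x b where p: "p = (x, b)" by (cases p)
    have x: "x \<in> X" using Cons p by simp
    have "?c [(x, b)] \<in> generate ?G ?S"
    proof (cases b)
      case True
      then show ?thesis using x by (auto intro: generate.incl)
    next
      case False
      have "(([(x, False)] @ [(x, True)]), []) \<in> pres_rel X R"
        using pres_rel.cancel[of "[]" X "[]" x False R] x by simp
      then have "?c [(x, False)] \<otimes>\<^bsub>?G\<^esub> ?c [(x, True)] = ?c []"
        using x equiv_class_eq[OF equiv_pres_rel, of "[(x, False), (x, True)]" "[]" X R]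
        by (subst presented_group_mult) auto
      then have "?c [(x, False)] \<otimes>\<^bsub>?G\<^esub> ?c [(x, True)] = \<one>\<^bsub>?G\<^esub>"
        by (simp add: presented_group_def)
      then have "?c [(x, False)] = inv\<^bsub>?G\<^esub> ?c [(x, True)]"
        by (rule inv_equality[symmetric]) (use x in \<open>simp_all add: carr\<close>)
      then show ?thesis using False x by (auto intro: generate.inv)
    qed
    moreover have "?c (p # w) = ?c [(x, b)] \<otimes>\<^bsub>?G\<^esub> ?c w"
      using Cons p by (subst presented_group_mult) auto
    ultimately show ?case using Cons by (auto intro: generate.eng)
  qed
  then have "carrier ?G \<subseteq> generate ?G ?S" unfolding carr by (rule image_subsetI)
  with generate_incl[OF S] show ?thesis by (rule subset_antisym)
qed

lemma hom_eq_on_generate: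
  assumes "group G" "group K" "h \<in> hom G K" "k \<in> hom G K" "S \<subseteq> carrier G"
    and eq: "\<And>s. s \<in> S \<Longrightarrow> h s = k s" and "a \<in> generate G S"
  shows "h a = k a"
proof -
  interpret h: group_hom G K h using assms by (simp add: group_hom_def group_hom_axioms_def)
  interpret k: group_hom G K k using assms by (simp add: group_hom_def group_hom_axioms_def)
  show ?thesis
    using assms(7)
  proof (induction rule: generate.induct)
    case (inv s)
    then show ?case using assms(5) eq by (metis h.hom_inv k.hom_inv subsetD)
  next
    case (eng a b)
    then show ?case
      using group.generate_in_carrier[OF assms(1,5)] by simp
  qed (auto simp: eq)
qed

lemma (in group) generate_commute:
  assumes "S \<subseteq> carrier G" "a \<in> carrier G" "\<And>s. s \<in> S \<Longrightarrow> a \<otimes> s = s \<otimes> a"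
    and "b \<in> generate G S"
  shows "a \<otimes> b = b \<otimes> a"
  using assms(4)
proof (induction rule: generate.induct)
  case (inv s)
  then have "a \<otimes> s = s \<otimes> a" "s \<in> carrier G" using assms by auto
  then show ?case
    using assms(2) by (metis inv_closed inv_solve_left inv_solve_right m_assoc m_closed)
next
  case (eng b c)
  then show ?case
    using generate_in_carrier[OF assms(1)] assms(2) by (metis m_assoc)
qed (use assms in auto)

text \<open>The centraliser argument is used twice: each \<open>t\<close> commutes with all of
  \<open>generate G S\<close>, in particular with \<open>a\<close>; hence \<open>a\<close> commutes
  with all of \<open>generate G T\<close>.\<close>

lemma (in group) generate_commute2:
  assumes "S \<subseteq> carrier G" "T \<subseteq> carrier G"
    and "\<And>s t. s \<in> S \<Longrightarrow> t \<in> T \<Longrightarrow> s \<otimes> t = t \<otimes> s"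
    and "a \<in> generate G S" "b \<in> generate G T"
  shows "a \<otimes> b = b \<otimes> a"
proof (rule generate_commute[OF assms(2) _ _ assms(5)])
  show "a \<in> carrier G" using generate_in_carrier assms by blast
  fix t assume t: "t \<in> T"
  show "a \<otimes> t = t \<otimes> a"
  proof (rule generate_commute[OF assms(1) _ _ assms(4), symmetric])
    show "t \<in> carrier G" using t assms(2) by auto
    show "t \<otimes> s = s \<otimes> t" if "s \<in> S" for s using assms(3)[OF that t] by simp
  qed
qed


section \<open>Closed sets of a graph\<close>

locale pc_graph = graph \<Gamma> for \<Gamma> :: "('a, 'b) pre_digraph"
begin

abbreviation X where "X \<equiv> verts \<Gamma>"
abbreviation G where "G \<equiv> pc_group \<Gamma>"
abbreviation g where "g \<equiv> gen \<Gamma>"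
abbreviation cl1 where "cl1 x \<equiv> cl \<Gamma> {x}"

sublocale G: group G
  unfolding pc_group_def by (rule group_presented_group)

lemma finite_X: "finite X" by simp

lemma graph_dist_le_1_iff:
  assumes "u \<in> X" "v \<in> X"
  shows "graph_dist \<Gamma> u v \<le> 1 \<longleftrightarrow> u = v \<or> u \<rightarrow>\<^bsub>\<Gamma>\<^esub> v"
proof
  assume "graph_dist \<Gamma> u v \<le> 1"
  \<comment> \<open>A strict bound on the infimum yields an actual walk. Its cost is a natural
    number, so a cost below 2 means at most one arc.\<close>
  then have "(INF p\<in>{p. awalk u p v}. ereal (awalk_cost (\<lambda>_. 1) p)) < 2"
    unfolding graph_dist_def \<mu>_def by (rule order.strict_trans1) simp
  then obtain p where p: "awalk u p v" "ereal (awalk_cost (\<lambda>_. 1) p) < 2"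
    unfolding INF_less_iff by auto
  have "awalk_cost (\<lambda>_. 1) p = real (length p)" by (induction p) auto
  then have "length p < 2" using p(2) by auto
  then consider "p = []" | a where "p = [a]"
    by (cases p) auto
  then show "u = v \<or> u \<rightarrow>\<^bsub>\<Gamma>\<^esub> v"
    by cases (use p(1) in \<open>auto simp: awalk_Cons_iff awalk_Nil_iff arc_to_ends_def in_arcs_imp_in_arcs_ends\<close>)
next
  assume "u = v \<or> u \<rightarrow>\<^bsub>\<Gamma>\<^esub> v"
  then show "graph_dist \<Gamma> u v \<le> 1"
  proof
    assume "u = v"
    then have "awalk u [] v" using assms by (simp add: awalk_Nil_iff)
    from min_cost_le_walk_cost[OF this, of "\<lambda>_. 1"] show ?thesis
      unfolding graph_dist_def by (rule order.trans) simp
  next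
    assume "u \<rightarrow>\<^bsub>\<Gamma>\<^esub> v"
    then obtain a where "awalk u [a] v"
      by (auto simp: arcs_ends_def arc_to_ends_def intro: arc_implies_awalk)
    from min_cost_le_walk_cost[OF this, of "\<lambda>_. 1"] show ?thesis
      unfolding graph_dist_def by (rule order.trans) simp
  qed
qed

lemma adj_sym: "u \<rightarrow>\<^bsub>\<Gamma>\<^esub> v \<Longrightarrow> v \<rightarrow>\<^bsub>\<Gamma>\<^esub> u"
  using sym_arcs unfolding symmetric_def by (rule symD)

lemma adj_X: "u \<rightarrow>\<^bsub>\<Gamma>\<^esub> v \<Longrightarrow> u \<in> X \<and> v \<in> X"
  using adj_in_verts by blast

lemma perp_iff:
  "Y \<subseteq> X \<Longrightarrow> u \<in> perp \<Gamma> Y \<longleftrightarrow> u \<in> X \<and> (\<forall>y\<in>Y. u = y \<or> u \<rightarrow>\<^bsub>\<Gamma>\<^esub> y)"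
  by (auto simp: perp_def graph_dist_le_1_iff subset_iff)

lemma perp_subset: "perp \<Gamma> Y \<subseteq> X"
  by (auto simp: perp_def)

lemma perp_antimono: "Y \<subseteq> Z \<Longrightarrow> perp \<Gamma> Z \<subseteq> perp \<Gamma> Y"
  by (auto simp: perp_def)

lemma cl_mono: "Y \<subseteq> Z \<Longrightarrow> cl \<Gamma> Y \<subseteq> cl \<Gamma> Z"
  unfolding cl_def by (intro perp_antimono)

lemma cl_subset: "cl \<Gamma> Y \<subseteq> X"
  unfolding cl_def by (rule perp_subset)

lemma cl_extensive:
  assumes Y: "Y \<subseteq> X"
  shows "Y \<subseteq> cl \<Gamma> Y"
proof
  fix t assume t: "t \<in> Y"
  have "t = y \<or> t \<rightarrow>\<^bsub>\<Gamma>\<^esub> y" if "y \<in> perp \<Gamma> Y" for y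
    using that t adj_sym unfolding perp_iff[OF Y] by auto
  then show "t \<in> cl \<Gamma> Y" unfolding cl_def perp_iff[OF perp_subset] using t Y by blast
qed

lemma cl_closed: "Y \<subseteq> X \<Longrightarrow> cl \<Gamma> Y \<in> closed_sets \<Gamma>"
proof -
  assume Y: "Y \<subseteq> X"
  have "perp \<Gamma> (cl \<Gamma> Y) = perp \<Gamma> Y"
    using perp_antimono[OF cl_extensive[OF Y]] cl_extensive[OF perp_subset[of Y]]
    unfolding cl_def by (rule subset_antisym)
  then show ?thesis using cl_subset[of Y] unfolding closed_sets_def cl_def by simp
qed

text \<open>Orthogonality of two vertices is symmetric, so being orthogonal to all of
  \<open>perp \<Gamma> {x}\<close> is an inclusion of complements. In this form the preorder axioms
  are those of inclusion.\<close>

lemma in_cl1_iff: "x \<in> X \<Longrightarrow> y \<in> cl1 x \<longleftrightarrow> y \<in> X \<and> perp \<Gamma> {x} \<subseteq> perp \<Gamma> {y}"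
proof -
  have "y \<in> cl1 x \<longleftrightarrow> y \<in> X \<and> (\<forall>u\<in>perp \<Gamma> {x}. y = u \<or> y \<rightarrow>\<^bsub>\<Gamma>\<^esub> u)"
    unfolding cl_def by (rule perp_iff[OF perp_subset])
  also have "\<dots> \<longleftrightarrow> y \<in> X \<and> (\<forall>u\<in>perp \<Gamma> {x}. u \<in> perp \<Gamma> {y})"
  proof (intro conj_cong ball_cong HOL.refl)
    fix u assume "y \<in> X" "u \<in> perp \<Gamma> {x}"
    then show "(y = u \<or> y \<rightarrow>\<^bsub>\<Gamma>\<^esub> u) \<longleftrightarrow> u \<in> perp \<Gamma> {y}"
      using perp_iff[of "{y}" u] adj_sym[of u y] adj_sym[of y u] perp_subset[of "{x}"] by auto
  qed
  finally show ?thesis by blast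
qed

lemma cl1_X: "y \<in> cl1 x \<Longrightarrow> y \<in> X"
  using cl_subset by blast

lemma cl1_refl: "x \<in> X \<Longrightarrow> x \<in> cl1 x"
  by (simp add: in_cl1_iff)

lemma cl1_trans: "x \<in> X \<Longrightarrow> y \<in> cl1 x \<Longrightarrow> z \<in> cl1 y \<Longrightarrow> z \<in> cl1 x"
  using in_cl1_iff[of x y] in_cl1_iff[of y z] in_cl1_iff[of x z] by auto

lemma cl1_subset_iff: "x \<in> X \<Longrightarrow> y \<in> X \<Longrightarrow> cl1 y \<subseteq> cl1 x \<longleftrightarrow> y \<in> cl1 x"
  using cl1_refl[of y] cl1_trans[of x y] by auto

lemma cl1_subset_closed: "Y \<in> closed_sets \<Gamma> \<Longrightarrow> x \<in> Y \<Longrightarrow> cl1 x \<subseteq> Y"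
  unfolding closed_sets_def using cl_mono[of "{x}" Y] by auto

text \<open>One end is moved at a time: x' lies in x^perp, hence in y^perp; by symmetry y lies in
  x'^perp, hence in y'^perp. The case \<open>x = x'\<close> makes \<open>cl1 x\<close> a clique; the
  adjacent case makes the images of adjacent generators commute.\<close>

lemma adj_cl1:
  assumes "x = x' \<or> x \<rightarrow>\<^bsub>\<Gamma>\<^esub> x'" "x \<in> X" "x' \<in> X" "y \<in> cl1 x" "y' \<in> cl1 x'"
  shows "y = y' \<or> y \<rightarrow>\<^bsub>\<Gamma>\<^esub> y'"
proof -
  have "x' \<in> perp \<Gamma> {x}" using assms(1-3) adj_sym[of x x'] perp_iff[of "{x}" x'] by auto
  then have "x' \<in> perp \<Gamma> {y}" using assms(4) in_cl1_iff[OF assms(2), of y] by auto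
  then have "y \<in> perp \<Gamma> {x'}"
    using cl1_X[OF assms(4)] assms(3) adj_sym[of x' y] perp_iff[of "{y}" x'] perp_iff[of "{x'}" y]
    by auto
  then have "y \<in> perp \<Gamma> {y'}" using assms(5) in_cl1_iff[OF assms(3), of y'] by auto
  then show ?thesis using cl1_X[OF assms(5)] perp_iff[of "{y'}" y] by auto
qed

lemma perp_class_iff: "x \<in> X \<Longrightarrow> y \<in> perp_class \<Gamma> x \<longleftrightarrow> y \<in> cl1 x \<and> x \<in> cl1 y"
  using in_cl1_iff[of x y] in_cl1_iff[of y x] unfolding perp_class_def by auto


section \<open>Exponents in the partially commutative group\<close>

lemma gen_closed: "x \<in> X \<Longrightarrow> g x \<in> carrier G"
  unfolding gen_def pc_group_def by (auto simp: presented_group_def quotient_def)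

lemma gen_generate: "generate G (g ` X) = carrier G"
  using presented_group_generated[of X "{([(x, True), (y, True)], [(y, True), (x, True)]) |x y. x \<rightarrow>\<^bsub>\<Gamma>\<^esub> y}"]
  unfolding gen_def pc_group_def by simp

lemma gen_commute:
  assumes "x = y \<or> x \<rightarrow>\<^bsub>\<Gamma>\<^esub> y"
  shows "g x \<otimes>\<^bsub>G\<^esub> g y = g y \<otimes>\<^bsub>G\<^esub> g x"
  using assms
proof
  let ?R = "{([(x, True), (y, True)], [(y, True), (x, True)]) |x y. x \<rightarrow>\<^bsub>\<Gamma>\<^esub> y}"
  assume xy: "x \<rightarrow>\<^bsub>\<Gamma>\<^esub> y"
  then have X: "x \<in> X" "y \<in> X" using adj_X by auto
  have "([] @ [(x, True), (y, True)] @ [], [] @ [(y, True), (x, True)] @ []) \<in> pres_rel X ?R"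
    by (rule pres_rel.relation) (use X xy in auto)
  then have "pres_rel X ?R `` {[(x, True)] @ [(y, True)]} = pres_rel X ?R `` {[(y, True)] @ [(x, True)]}"
    using equiv_class_eq[OF equiv_pres_rel] by simp
  then show ?thesis
    unfolding gen_def pc_group_def using X by (simp add: presented_group_mult)
qed auto

lemma hom_exists:
  assumes K: "group K" and f: "f \<in> X \<rightarrow> carrier K"
    and "\<And>x y. x \<rightarrow>\<^bsub>\<Gamma>\<^esub> y \<Longrightarrow> f x \<otimes>\<^bsub>K\<^esub> f y = f y \<otimes>\<^bsub>K\<^esub> f x"
  shows "\<exists>h\<in>hom G K. \<forall>x\<in>X. h (g x) = f x"
proof -
  interpret K: group K by (rule K)
  have "eval_word K f l = eval_word K f r"
    if lr: "(l, r) \<in> {([(x, True), (y, True)], [(y, True), (x, True)]) |x y. x \<rightarrow>\<^bsub>\<Gamma>\<^esub> y}" for l r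
  proof -
    obtain x y where xy: "x \<rightarrow>\<^bsub>\<Gamma>\<^esub> y" and "l = [(x, True), (y, True)]" "r = [(y, True), (x, True)]"
      using lr by auto
    moreover have "f x \<in> carrier K" "f y \<in> carrier K" using f adj_X[OF xy] by auto
    ultimately show ?thesis using assms(3)[OF xy] by simp
  qed
  from presented_group_hom_exists[OF K f this] show ?thesis
    unfolding gen_def pc_group_def by blast
qed

lemma hom_eqI:
  assumes "group K" "h \<in> hom G K" "k \<in> hom G K" "\<And>x. x \<in> X \<Longrightarrow> h (g x) = k (g x)" "a \<in> carrier G"
  shows "h a = k a"
  by (rule hom_eq_on_generate[OF G.group_axioms assms(1-3), of "g ` X"])
    (use assms gen_closed gen_generate in auto)

text \<open>The exponent sum of the vertex \<open>y\<close>. It is picked by \<open>SOME\<close>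
  because elements of \<open>hom\<close> are unconstrained outside the carrier; on the carrier the
  values at the generators determine it.\<close>

definition expo :: "'a \<Rightarrow> 'a word set \<Rightarrow> int" where
  "expo y = (SOME e. e \<in> hom G integer_group \<and> (\<forall>x\<in>X. e (g x) = (if x = y then 1 else 0)))"

lemma expo: "expo y \<in> hom G integer_group" "x \<in> X \<Longrightarrow> expo y (g x) = (if x = y then 1 else 0)"
proof -
  have "\<exists>e. e \<in> hom G integer_group \<and> (\<forall>x\<in>X. e (g x) = (if x = y then 1 else 0))"
    using hom_exists[OF group_integer_group, of "\<lambda>x. if x = y then 1 else 0"] by auto
  from someI_ex[OF this] show "expo y \<in> hom G integer_group"
    "x \<in> X \<Longrightarrow> expo y (g x) = (if x = y then 1 else 0)"
    unfolding expo_def by auto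
qed

lemma expo_mult: "a \<in> carrier G \<Longrightarrow> b \<in> carrier G \<Longrightarrow> expo y (a \<otimes>\<^bsub>G\<^esub> b) = expo y a + expo y b"
  using expo(1)[of y] by (auto simp: hom_def)

lemma expo_group_hom: "group_hom G integer_group (expo y)"
  using expo(1) by (simp add: group_hom_def group_hom_axioms_def G.group_axioms)

lemma inv_integer_group: "inv\<^bsub>integer_group\<^esub> k = - k"
  by (rule group.inv_equality) auto

lemma expo_one: "expo y \<one>\<^bsub>G\<^esub> = 0"
  using group_hom.hom_one[OF expo_group_hom] by simp

lemma expo_inv: "a \<in> carrier G \<Longrightarrow> expo y (inv\<^bsub>G\<^esub> a) = - expo y a"
  using group_hom.hom_inv[OF expo_group_hom] by (simp add: inv_integer_group)

lemma expo_int_pow_gen: "x \<in> X \<Longrightarrow> expo y (g x [^]\<^bsub>G\<^esub> (k::int)) = (if x = y then k else 0)"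
proof -
  assume x: "x \<in> X"
  have nat: "expo y (g x [^]\<^bsub>G\<^esub> n) = (if x = y then int n else 0)" for n :: nat
    by (induction n) (auto simp: expo_one expo_mult gen_closed expo x)
  have "expo y (inv\<^bsub>G\<^esub> (g x [^]\<^bsub>G\<^esub> n)) = (if x = y then - int n else 0)" for n :: nat
    using nat[of n] by (simp add: expo_inv gen_closed x)
  then show ?thesis
    unfolding int_pow_def2 using nat by (cases "x = y") (simp_all del: pow_nat)
qed

section \<open>Subgroups generated by sets of vertices\<close>

lemma gen_img: "Y \<subseteq> X \<Longrightarrow> g ` Y \<subseteq> carrier G"
  using gen_closed by auto

lemma gen_subgroup_subgroup: "Y \<subseteq> X \<Longrightarrow> subgroup (gen_subgroup \<Gamma> Y) G"
  unfolding gen_subgroup_def by (rule G.generate_is_subgroup[OF gen_img])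

lemma gen_in_gen_subgroup: "x \<in> Y \<Longrightarrow> g x \<in> gen_subgroup \<Gamma> Y"
  unfolding gen_subgroup_def by (auto intro: generate.incl)

lemma gen_subgroup_mono: "Y \<subseteq> Z \<Longrightarrow> gen_subgroup \<Gamma> Y \<subseteq> gen_subgroup \<Gamma> Z"
  unfolding gen_subgroup_def by (intro G.mono_generate image_mono)

lemma gen_subgroup_closed: "Y \<subseteq> X \<Longrightarrow> a \<in> gen_subgroup \<Gamma> Y \<Longrightarrow> a \<in> carrier G"
  using subgroup.mem_carrier[OF gen_subgroup_subgroup] .

lemma gen_subgroup_commute:
  assumes "Y \<subseteq> X" "Z \<subseteq> X" "\<And>y z. y \<in> Y \<Longrightarrow> z \<in> Z \<Longrightarrow> y = z \<or> y \<rightarrow>\<^bsub>\<Gamma>\<^esub> z"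
    and "a \<in> gen_subgroup \<Gamma> Y" "b \<in> gen_subgroup \<Gamma> Z"
  shows "a \<otimes>\<^bsub>G\<^esub> b = b \<otimes>\<^bsub>G\<^esub> a"
proof (rule G.generate_commute2[OF gen_img[OF assms(1)] gen_img[OF assms(2)]])
  fix s t assume "s \<in> g ` Y" "t \<in> g ` Z"
  then show "s \<otimes>\<^bsub>G\<^esub> t = t \<otimes>\<^bsub>G\<^esub> s" using gen_commute assms(3) by blast
qed (use assms in \<open>simp_all add: gen_subgroup_def\<close>)

lemma expo_outside:
  assumes "Y \<subseteq> X" "a \<in> gen_subgroup \<Gamma> Y" "y \<notin> Y"
  shows "expo y a = 0"
proof -
  have "(\<lambda>_. 0) \<in> hom G integer_group" by (auto simp: hom_def)
  then show ?thesis
    by (rule hom_eq_on_generate[OF G.group_axioms group_integer_group expo(1) _ gen_img[OF assms(1)]])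
      (use assms expo(2)[of _ y] in \<open>auto simp: gen_subgroup_def\<close>)
qed

text \<open>Powers of \<open>g y\<close> commute with \<open>gen_subgroup \<Gamma> Y\<close>, so
  they can be collected at the front. This peels one vertex off a clique in inductions.\<close>

lemma gen_subgroup_insert:
  assumes "insert y Y \<subseteq> X" "\<And>z. z \<in> Y \<Longrightarrow> y \<rightarrow>\<^bsub>\<Gamma>\<^esub> z \<or> y = z"
    and "a \<in> gen_subgroup \<Gamma> (insert y Y)"
  shows "\<exists>k::int. \<exists>b\<in>gen_subgroup \<Gamma> Y. a = g y [^]\<^bsub>G\<^esub> k \<otimes>\<^bsub>G\<^esub> b"
proof -
  have y: "g y \<in> carrier G" and Y: "Y \<subseteq> X" using assms gen_closed by auto
  interpret Y: subgroup "gen_subgroup \<Gamma> Y" G by (rule gen_subgroup_subgroup[OF Y])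
  have comm: "g y [^]\<^bsub>G\<^esub> (k::int) \<otimes>\<^bsub>G\<^esub> b = b \<otimes>\<^bsub>G\<^esub> g y [^]\<^bsub>G\<^esub> k"
    if "b \<in> gen_subgroup \<Gamma> Y" for k b
  proof (rule gen_subgroup_commute[OF _ Y _ _ that, of "{y}"])
    show "g y [^]\<^bsub>G\<^esub> k \<in> gen_subgroup \<Gamma> {y}"
      using G.subgroup_int_pow_closed[OF gen_subgroup_subgroup gen_in_gen_subgroup] assms by blast
  qed (use assms in auto)
  show ?thesis
    using assms(3) unfolding gen_subgroup_def[of _ "insert y Y"]
  proof (induction rule: generate.induct)
    case one
    show ?case by (rule exI[of _ 0], rule bexI[of _ "\<one>\<^bsub>G\<^esub>"]) auto
  next
    case (incl h)
    then consider "h = g y" | z where "z \<in> Y" "h = g z" by auto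
    then show ?case
    proof cases
      case 1
      then show ?thesis using y by (intro exI[of _ 1] bexI[of _ "\<one>\<^bsub>G\<^esub>"]) auto
    next
      case 2
      then show ?thesis
        using gen_in_gen_subgroup[of z Y] by (intro exI[of _ 0] bexI[of _ h]) auto
    qed
  next
    case (inv h)
    then consider "h = g y" | z where "z \<in> Y" "h = g z" by auto
    then show ?case
    proof cases
      case 1
      then show ?thesis
        using y by (intro exI[of _ "-1"] bexI[of _ "\<one>\<^bsub>G\<^esub>"]) (auto simp: G.int_pow_neg)
    next
      case 2
      then show ?thesis
        using gen_in_gen_subgroup[of z Y] by (intro exI[of _ 0] bexI[of _ "inv\<^bsub>G\<^esub> h"]) auto
    qed
  next
    case (eng a a')
    then obtain k k' :: int and b b' where
      b: "b \<in> gen_subgroup \<Gamma> Y" "b' \<in> gen_subgroup \<Gamma> Y"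
      and a: "a = g y [^]\<^bsub>G\<^esub> k \<otimes>\<^bsub>G\<^esub> b" "a' = g y [^]\<^bsub>G\<^esub> k' \<otimes>\<^bsub>G\<^esub> b'" by blast
    note bc = Y.mem_carrier[OF b(1)] Y.mem_carrier[OF b(2)]
    have "a \<otimes>\<^bsub>G\<^esub> a' = g y [^]\<^bsub>G\<^esub> k \<otimes>\<^bsub>G\<^esub> (b \<otimes>\<^bsub>G\<^esub> g y [^]\<^bsub>G\<^esub> k') \<otimes>\<^bsub>G\<^esub> b'"
      using bc y a by (simp add: G.m_assoc)
    also have "\<dots> = g y [^]\<^bsub>G\<^esub> k \<otimes>\<^bsub>G\<^esub> (g y [^]\<^bsub>G\<^esub> k' \<otimes>\<^bsub>G\<^esub> b) \<otimes>\<^bsub>G\<^esub> b'"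
      using comm[OF b(1)] by simp
    also have "\<dots> = g y [^]\<^bsub>G\<^esub> (k + k') \<otimes>\<^bsub>G\<^esub> (b \<otimes>\<^bsub>G\<^esub> b')"
      using bc y by (simp add: G.m_assoc G.int_pow_mult)
    finally show ?case using b by blast
  qed
qed

section \<open>Cliques generate free abelian subgroups\<close>

definition clique :: "'a set \<Rightarrow> bool" where
  "clique Q \<longleftrightarrow> Q \<subseteq> X \<and> (\<forall>y\<in>Q. \<forall>z\<in>Q. y = z \<or> y \<rightarrow>\<^bsub>\<Gamma>\<^esub> z)"

lemma clique_cl1: "x \<in> X \<Longrightarrow> clique (cl1 x)"
  unfolding clique_def using cl1_X adj_cl1 by blast

text \<open>Once \<open>g y [^] k\<close> is split off, the rest has exponent 0 at \<open>y\<close>;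
  so \<open>k\<close> is the exponent of \<open>y\<close> and vanishes, and the rest falls under the
  induction hypothesis.\<close>

lemma clique_expo_eq_one:
  assumes "clique Q" "a \<in> gen_subgroup \<Gamma> Q" "\<And>y. y \<in> Q \<Longrightarrow> expo y a = 0"
  shows "a = \<one>\<^bsub>G\<^esub>"
proof -
  have "finite Q" using assms(1) finite_X finite_subset unfolding clique_def by blast
  then show ?thesis
    using assms
  proof (induction arbitrary: a)
    case empty
    then show ?case by (simp add: gen_subgroup_def G.generate_empty)
  next
    case (insert y Q)
    then have Q: "insert y Q \<subseteq> X" "clique Q" by (auto simp: clique_def)
    obtain k :: int and b where b: "b \<in> gen_subgroup \<Gamma> Q" "a = g y [^]\<^bsub>G\<^esub> k \<otimes>\<^bsub>G\<^esub> b"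
      using gen_subgroup_insert[OF Q(1) _ insert.prems(2)] insert.prems(1) unfolding clique_def by blast
    have bc: "b \<in> carrier G" "g y \<in> carrier G" using b Q gen_subgroup_closed gen_closed by auto
    have "expo y a = k"
      using b bc Q insert.hyps by (auto simp: expo_mult expo_int_pow_gen expo_outside)
    then have "a = b" using insert.prems(3)[of y] b bc by simp
    then show ?case using insert.IH[OF Q(2)] b insert.prems by auto
  qed
qed

lemma clique_expo_eqI:
  assumes "clique Q" "a \<in> gen_subgroup \<Gamma> Q" "b \<in> gen_subgroup \<Gamma> Q" "\<And>y. y \<in> Q \<Longrightarrow> expo y a = expo y b"
  shows "a = b"
proof -
  interpret Q: subgroup "gen_subgroup \<Gamma> Q" G
    using assms(1) by (intro gen_subgroup_subgroup) (auto simp: clique_def)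
  have "a \<otimes>\<^bsub>G\<^esub> inv\<^bsub>G\<^esub> b = \<one>\<^bsub>G\<^esub>"
    by (rule clique_expo_eq_one[OF assms(1)]) (use assms Q.mem_carrier in \<open>auto simp: expo_mult expo_inv\<close>)
  then show ?thesis using assms Q.mem_carrier by (metis G.inv_closed G.inv_equality G.inv_inv)
qed

text \<open>Exponents are additive, so a product of powers has the prescribed ones whatever the
  order of its factors.\<close>

lemma expo_realize:
  assumes "Q \<subseteq> X"
  shows "\<exists>a\<in>gen_subgroup \<Gamma> Q. \<forall>y\<in>Q. expo y a = v y"
proof -
  have "finite Q" using assms finite_X finite_subset by blast
  then show ?thesis
    using assms
  proof induction
    case empty
    show ?case by (auto simp: gen_subgroup_def intro: generate.one)
  next
    case (insert x Q)
    then obtain a where a: "a \<in> gen_subgroup \<Gamma> Q" "\<forall>y\<in>Q. expo y a = v y" by auto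
    let ?b = "g x [^]\<^bsub>G\<^esub> v x \<otimes>\<^bsub>G\<^esub> a"
    interpret S: subgroup "gen_subgroup \<Gamma> (insert x Q)" G using insert by (intro gen_subgroup_subgroup) auto
    have ac: "a \<in> carrier G" "g x \<in> carrier G" using a insert gen_subgroup_closed gen_closed by auto
    have "?b \<in> gen_subgroup \<Gamma> (insert x Q)"
      using a gen_subgroup_mono[of Q "insert x Q"] gen_in_gen_subgroup[of x "insert x Q"]
        G.subgroup_int_pow_closed[OF S.subgroup_axioms] by (intro S.m_closed) auto
    moreover have "expo y ?b = v y" if "y \<in> insert x Q" for y
      using that a ac insert by (auto simp: expo_mult expo_int_pow_gen expo_outside)
    ultimately show ?case by blast
  qed
qed

section \<open>Endomorphisms as matrices\<close>

text \<open>Testing the closures of single vertices is enough, because a closed set contains the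
  closure of each of its vertices. Extensionality lets agreement on the carrier give equality of
  functions.\<close>

definition endos :: "('a word set \<Rightarrow> 'a word set) set" where
  "endos = {\<phi> \<in> hom G G \<inter> extensional (carrier G). \<forall>x\<in>X. \<phi> (g x) \<in> gen_subgroup \<Gamma> (cl1 x)}"

text \<open>Columns are images of generators; with maps written on the left, composition then
  corresponds to the matrix product in the same order.\<close>

definition coef :: "('a word set \<Rightarrow> 'a word set) \<Rightarrow> 'a \<Rightarrow> 'a \<Rightarrow> int" where
  "coef \<phi> y x = expo y (\<phi> (g x))"

definition supported :: "('a \<Rightarrow> 'a \<Rightarrow> int) \<Rightarrow> bool" where
  "supported M \<longleftrightarrow> (\<forall>x\<in>X. \<forall>y\<in>X. M y x \<noteq> 0 \<longrightarrow> y \<in> cl1 x)"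

text \<open>Matrices are functions on the whole vertex type, so only their entries over
  \<open>X\<close> carry meaning. Numbering the vertices is postponed until complex matrices are
  needed.\<close>

definition mat_eq :: "('a \<Rightarrow> 'a \<Rightarrow> int) \<Rightarrow> ('a \<Rightarrow> 'a \<Rightarrow> int) \<Rightarrow> bool" where
  "mat_eq M N \<longleftrightarrow> (\<forall>x\<in>X. \<forall>y\<in>X. M y x = N y x)"

definition mat_one :: "'a \<Rightarrow> 'a \<Rightarrow> int" where
  "mat_one y x = (if y = x then 1 else 0)"

definition mat_times :: "('a \<Rightarrow> 'a \<Rightarrow> int) \<Rightarrow> ('a \<Rightarrow> 'a \<Rightarrow> int) \<Rightarrow> 'a \<Rightarrow> 'a \<Rightarrow> int" where
  "mat_times M N z x = (\<Sum>y\<in>X. M z y * N y x)"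

abbreviation comp where "comp \<equiv> compose (carrier G)"
abbreviation ide where "ide \<equiv> \<lambda>a\<in>carrier G. a"

lemma mat_eqI: "(\<And>x y. x \<in> X \<Longrightarrow> y \<in> X \<Longrightarrow> M y x = N y x) \<Longrightarrow> mat_eq M N"
  by (simp add: mat_eq_def)

lemma mat_eqD: "mat_eq M N \<Longrightarrow> x \<in> X \<Longrightarrow> y \<in> X \<Longrightarrow> M y x = N y x"
  by (simp add: mat_eq_def)

lemma mat_eq_sym: "mat_eq M N \<Longrightarrow> mat_eq N M"
  by (simp add: mat_eq_def)

lemma mat_eq_trans: "mat_eq M N \<Longrightarrow> mat_eq N P \<Longrightarrow> mat_eq M P"
  by (simp add: mat_eq_def)

lemma supportedD: "supported M \<Longrightarrow> x \<in> X \<Longrightarrow> y \<in> X \<Longrightarrow> y \<notin> cl1 x \<Longrightarrow> M y x = 0"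
  by (auto simp: supported_def)

lemma supported_mat_one: "supported mat_one"
  by (simp add: supported_def mat_one_def cl1_refl)

lemma supported_mat_times:
  assumes "supported M" "supported N"
  shows "supported (mat_times M N)"
  unfolding supported_def
proof (intro ballI impI)
  fix x z assume xz: "x \<in> X" "z \<in> X" and "mat_times M N z x \<noteq> 0"
  then obtain y where y: "y \<in> X" "M z y * N y x \<noteq> 0"
    unfolding mat_times_def by (meson sum.not_neutral_contains_not_neutral)
  then show "z \<in> cl1 x"
    using assms xz cl1_trans[of x y z] by (auto simp: supported_def)
qed

lemma mat_times_cong: "mat_eq M M' \<Longrightarrow> mat_eq N N' \<Longrightarrow> mat_eq (mat_times M N) (mat_times M' N')"
  by (auto simp: mat_eq_def mat_times_def intro!: sum.cong)

lemma endos_hom: "\<phi> \<in> endos \<Longrightarrow> \<phi> \<in> hom G G"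
  by (simp add: endos_def)

lemma endos_gen: "\<phi> \<in> endos \<Longrightarrow> x \<in> X \<Longrightarrow> \<phi> (g x) \<in> gen_subgroup \<Gamma> (cl1 x)"
  by (simp add: endos_def)

lemma hom_G_closed: "\<phi> \<in> hom G G \<Longrightarrow> a \<in> carrier G \<Longrightarrow> \<phi> a \<in> carrier G"
  by (auto simp: hom_def)

lemma hom_image_gen_subgroup:
  assumes "\<phi> \<in> hom G G" "Y \<subseteq> X" "Z \<subseteq> X" "\<And>x. x \<in> Y \<Longrightarrow> \<phi> (g x) \<in> gen_subgroup \<Gamma> Z"
  shows "\<phi> ` gen_subgroup \<Gamma> Y \<subseteq> gen_subgroup \<Gamma> Z"
proof -
  interpret h: group_hom G G \<phi> using assms(1) by unfold_locales
  show ?thesis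
    unfolding gen_subgroup_def[of \<Gamma> Y] h.generate_img[OF gen_img[OF assms(2)], symmetric]
    by (rule G.generate_subgroup_incl[OF _ gen_subgroup_subgroup[OF assms(3)]]) (use assms(4) in blast)
qed

lemma endos_image:
  assumes "\<phi> \<in> endos" "Y \<subseteq> X" "\<And>x. x \<in> Y \<Longrightarrow> cl1 x \<subseteq> Y"
  shows "\<phi> ` gen_subgroup \<Gamma> Y \<subseteq> gen_subgroup \<Gamma> Y"
  by (rule hom_image_gen_subgroup[OF endos_hom[OF assms(1)] assms(2,2)])
    (use assms endos_gen gen_subgroup_mono in blast)

lemma endos_image_cl1: "\<phi> \<in> endos \<Longrightarrow> x \<in> X \<Longrightarrow> \<phi> ` gen_subgroup \<Gamma> (cl1 x) \<subseteq> gen_subgroup \<Gamma> (cl1 x)"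
  by (rule endos_image[OF _ cl_subset]) (use cl1_trans in blast)+

text \<open>As functions of \<open>a\<close>, both sides are homomorphisms into the integers, and on
  a generator the sum collapses to one matrix entry.\<close>

lemma expo_hom_apply:
  assumes "\<phi> \<in> hom G G" "a \<in> carrier G"
  shows "expo z (\<phi> a) = (\<Sum>y\<in>X. coef \<phi> z y * expo y a)"
proof (rule hom_eqI[OF group_integer_group _ _ _ assms(2)])
  show "(\<lambda>a. expo z (\<phi> a)) \<in> hom G integer_group"
    using assms(1) hom_G_closed[OF assms(1)] by (simp add: hom_def expo_mult)
  show "(\<lambda>a. \<Sum>y\<in>X. coef \<phi> z y * expo y a) \<in> hom G integer_group"
    by (auto simp: hom_def expo_mult algebra_simps sum.distrib)
  show "expo z (\<phi> (g x)) = (\<Sum>y\<in>X. coef \<phi> z y * expo y (g x))" if "x \<in> X" for x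
    using that by (simp add: coef_def expo sum.delta if_distrib[of "\<lambda>t. _ * t"] cong: if_cong)
qed

lemma coef_comp:
  assumes "\<phi> \<in> hom G G" "\<psi> \<in> hom G G" "x \<in> X"
  shows "coef (comp \<phi> \<psi>) z x = mat_times (coef \<phi>) (coef \<psi>) z x"
  using assms gen_closed[OF assms(3)] expo_hom_apply[OF assms(1), of "\<psi> (g x)" z] hom_G_closed[OF assms(2)]
  by (simp add: coef_def compose_def mat_times_def)

lemma mat_eq_coef_comp:
  "\<phi> \<in> endos \<Longrightarrow> \<psi> \<in> endos \<Longrightarrow> mat_eq (coef (comp \<phi> \<psi>)) (mat_times (coef \<phi>) (coef \<psi>))"
  by (simp add: mat_eq_def coef_comp endos_hom)

lemma mat_eq_coef_ide: "mat_eq (coef ide) mat_one"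
  by (auto simp: mat_eq_def coef_def mat_one_def expo gen_closed)

lemma ide_endos: "ide \<in> endos"
  unfolding endos_def
  by (auto simp: hom_def gen_closed gen_in_gen_subgroup cl1_refl)

lemma comp_endos: "\<phi> \<in> endos \<Longrightarrow> \<psi> \<in> endos \<Longrightarrow> comp \<phi> \<psi> \<in> endos"
proof -
  assume h: "\<phi> \<in> endos" "\<psi> \<in> endos"
  have "comp \<phi> \<psi> \<in> hom G G"
    using G.hom_compose[OF endos_hom[OF h(2)] endos_hom[OF h(1)]] by simp
  moreover have "comp \<phi> \<psi> (g x) \<in> gen_subgroup \<Gamma> (cl1 x)" if "x \<in> X" for x
    using endos_gen[OF h(2) that] endos_image_cl1[OF h(1) that] gen_closed[OF that]
    by (auto simp: compose_def)
  ultimately show ?thesis by (simp add: endos_def)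
qed

lemma supported_coef: "\<phi> \<in> endos \<Longrightarrow> supported (coef \<phi>)"
  unfolding supported_def coef_def using expo_outside[OF cl_subset endos_gen] by blast

text \<open>The image of a generator \<open>g x\<close> lies in the subgroup of the clique
  \<open>cl1 x\<close>, where exponents determine an element.\<close>

lemma endos_eqI:
  assumes "\<phi> \<in> endos" "\<psi> \<in> endos" "mat_eq (coef \<phi>) (coef \<psi>)"
  shows "\<phi> = \<psi>"
proof (rule extensionalityI)
  show "\<phi> \<in> extensional (carrier G)" "\<psi> \<in> extensional (carrier G)"
    using assms by (simp_all add: endos_def)
  show "\<phi> a = \<psi> a" if "a \<in> carrier G" for a
  proof (rule hom_eqI[OF G.group_axioms endos_hom[OF assms(1)] endos_hom[OF assms(2)] _ that])
    fix x assume x: "x \<in> X"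
    show "\<phi> (g x) = \<psi> (g x)"
      by (rule clique_expo_eqI[OF clique_cl1[OF x] endos_gen[OF assms(1) x] endos_gen[OF assms(2) x]])
        (use assms(3) x cl1_X in \<open>simp add: mat_eq_def coef_def\<close>)
  qed
qed

text \<open>Column \<open>x\<close> of \<open>M\<close> is realised by an element \<open>f x\<close>
  of G(cl(x)). By \<open>adj_cl1\<close> the elements chosen for adjacent vertices commute, so
  \<open>f\<close> extends to \<open>G\<close>. Outside the closure the exponent of
  \<open>f x\<close> and the entry of \<open>M\<close> are both zero.\<close>

lemma endos_exists:
  assumes "supported M"
  shows "\<exists>\<phi>\<in>endos. mat_eq (coef \<phi>) M"
proof -
  have "\<forall>x. \<exists>a. a \<in> gen_subgroup \<Gamma> (cl1 x) \<and> (\<forall>y\<in>cl1 x. expo y a = M y x)"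
    using expo_realize[OF cl_subset, of "{_}"] by (simp add: Bex_def)
  from choice[OF this] obtain f where
    f: "\<And>x. f x \<in> gen_subgroup \<Gamma> (cl1 x)" "\<And>x y. y \<in> cl1 x \<Longrightarrow> expo y (f x) = M y x" by blast
  have fX: "f \<in> X \<rightarrow> carrier G" using f(1) gen_subgroup_closed[OF cl_subset] by blast
  have "f x \<otimes>\<^bsub>G\<^esub> f y = f y \<otimes>\<^bsub>G\<^esub> f x" if "x \<rightarrow>\<^bsub>\<Gamma>\<^esub> y" for x y
    by (rule gen_subgroup_commute[OF cl_subset cl_subset _ f(1) f(1)])
      (rule adj_cl1[of x y], use that adj_X in auto)
  from hom_exists[OF G.group_axioms fX this] obtain h
    where h: "h \<in> hom G G" "\<And>x. x \<in> X \<Longrightarrow> h (g x) = f x" by blast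
  define \<phi> where "\<phi> = restrict h (carrier G)"
  have \<phi>: "\<phi> (g x) = f x" if "x \<in> X" for x
    using h(2) that gen_closed by (simp add: \<phi>_def)
  have "\<phi> \<in> hom G G"
    unfolding \<phi>_def using h(1) by (auto simp: hom_def)
  then have "\<phi> \<in> endos"
    unfolding endos_def using \<phi> f(1) by (auto simp: \<phi>_def)
  moreover have "mat_eq (coef \<phi>) M"
  proof (rule mat_eqI)
    fix x y assume "x \<in> X" "y \<in> X"
    then show "coef \<phi> y x = M y x"
      using f expo_outside[OF cl_subset f(1)] supportedD[OF assms]
      by (cases "y \<in> cl1 x") (simp_all add: coef_def \<phi>)
  qed
  ultimately show ?thesis by blast
qed

definition endo_of :: "('a \<Rightarrow> 'a \<Rightarrow> int) \<Rightarrow> 'a word set \<Rightarrow> 'a word set" where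
  "endo_of M = (THE \<phi>. \<phi> \<in> endos \<and> mat_eq (coef \<phi>) M)"

lemma endo_of_eqI:
  assumes "\<phi> \<in> endos" "mat_eq (coef \<phi>) M"
  shows "endo_of M = \<phi>"
  unfolding endo_of_def
proof (rule the_equality)
  fix \<psi> assume "\<psi> \<in> endos \<and> mat_eq (coef \<psi>) M"
  then show "\<psi> = \<phi>" using assms endos_eqI mat_eq_sym mat_eq_trans by metis
qed (use assms in blast)

lemma endo_of:
  assumes "supported M"
  shows "endo_of M \<in> endos" "mat_eq (coef (endo_of M)) M"
  using endos_exists[OF assms] endo_of_eqI by auto

lemma endo_of_coef: "\<phi> \<in> endos \<Longrightarrow> endo_of (coef \<phi>) = \<phi>"
  by (rule endo_of_eqI) (simp_all add: mat_eq_def)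

lemma endo_of_cong: "supported M \<Longrightarrow> mat_eq M N \<Longrightarrow> endo_of M = endo_of N"
  by (rule endo_of_eqI[symmetric]) (use endo_of mat_eq_trans in blast)+

lemma endo_of_mat_one: "endo_of mat_one = ide"
  by (rule endo_of_eqI[OF ide_endos mat_eq_coef_ide])

lemma endo_of_mat_times:
  assumes "supported M" "supported N"
  shows "comp (endo_of M) (endo_of N) = endo_of (mat_times M N)"
proof (rule endo_of_eqI[symmetric])
  show "comp (endo_of M) (endo_of N) \<in> endos" by (intro comp_endos endo_of assms)
  show "mat_eq (coef (comp (endo_of M) (endo_of N))) (mat_times M N)"
    by (rule mat_eq_trans[OF mat_eq_coef_comp mat_times_cong]) (intro endo_of assms)+
qed

section \<open>The stabiliser\<close>

lemma carrier_Aut: "carrier (Aut_pc \<Gamma>) = auto G"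
  by (simp add: AutoGroup_def)

lemma one_Aut: "\<one>\<^bsub>Aut_pc \<Gamma>\<^esub> = ide"
  by (simp add: AutoGroup_def BijGroup_def)

lemma mult_Aut: "\<phi> \<in> auto G \<Longrightarrow> \<psi> \<in> auto G \<Longrightarrow> \<phi> \<otimes>\<^bsub>Aut_pc \<Gamma>\<^esub> \<psi> = comp \<phi> \<psi>"
  by (simp add: AutoGroup_def BijGroup_def auto_def)

sublocale Aut: group "Aut_pc \<Gamma>"
  by (rule G.AutoGroup)

lemma auto_hom: "\<phi> \<in> auto G \<Longrightarrow> \<phi> \<in> hom G G"
  by (simp add: auto_def)

lemma auto_ext: "\<phi> \<in> auto G \<Longrightarrow> \<phi> \<in> extensional (carrier G)"
  by (simp add: auto_def Bij_def)

lemma autoI: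
  assumes "\<phi> \<in> endos" "\<psi> \<in> endos" "comp \<phi> \<psi> = ide" "comp \<psi> \<phi> = ide"
  shows "\<phi> \<in> auto G"
proof -
  have "bij_betw \<phi> (carrier G) (carrier G)"
  proof (rule bij_betw_byWitness[where f' = \<psi>])
    show "\<forall>a\<in>carrier G. \<psi> (\<phi> a) = a" "\<forall>a\<in>carrier G. \<phi> (\<psi> a) = a"
      using fun_cong[OF assms(3)] fun_cong[OF assms(4)] by (simp_all add: compose_def restrict_def) metis+
  qed (use assms hom_G_closed endos_hom in blast)+
  then show ?thesis using assms(1) by (simp add: auto_def Bij_def endos_def)
qed

text \<open>The inverse \<open>\<psi>\<close> also maps each G(Y) into itself, which turns
  containment of the image into equality.\<close>

lemma endos_bij_St:
  assumes "\<phi> \<in> endos" "\<psi> \<in> endos" "comp \<phi> \<psi> = ide" "comp \<psi> \<phi> = ide"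
  shows "\<phi> \<in> St \<Gamma>"
proof -
  have "\<phi> ` gen_subgroup \<Gamma> Y = gen_subgroup \<Gamma> Y" if Y: "Y \<in> closed_sets \<Gamma>" for Y
  proof
    have YX: "Y \<subseteq> X" using Y by (simp add: closed_sets_def)
    note img = endos_image[OF _ YX cl1_subset_closed[OF Y]]
    show "\<phi> ` gen_subgroup \<Gamma> Y \<subseteq> gen_subgroup \<Gamma> Y" by (rule img[OF assms(1)])
    show "gen_subgroup \<Gamma> Y \<subseteq> \<phi> ` gen_subgroup \<Gamma> Y"
    proof
      fix a assume a: "a \<in> gen_subgroup \<Gamma> Y"
      then have "\<phi> (\<psi> a) = a"
        using fun_cong[OF assms(3), of a] gen_subgroup_closed[OF YX] by (simp add: compose_def)
      moreover have "\<psi> a \<in> gen_subgroup \<Gamma> Y" using img[OF assms(2)] a by blast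
      ultimately show "a \<in> \<phi> ` gen_subgroup \<Gamma> Y" by (metis imageI)
    qed
  qed
  with autoI[OF assms] show ?thesis by (simp add: St_def)
qed

lemma St_auto: "\<phi> \<in> St \<Gamma> \<Longrightarrow> \<phi> \<in> auto G"
  by (simp add: St_def)

lemma St_endos: "\<phi> \<in> St \<Gamma> \<Longrightarrow> \<phi> \<in> endos"
proof -
  assume \<phi>: "\<phi> \<in> St \<Gamma>"
  have "\<phi> (g x) \<in> gen_subgroup \<Gamma> (cl1 x)" if "x \<in> X" for x
  proof -
    have "\<phi> ` gen_subgroup \<Gamma> (cl1 x) = gen_subgroup \<Gamma> (cl1 x)"
      using \<phi> cl_closed[of "{x}"] that by (simp add: St_def)
    then show ?thesis using gen_in_gen_subgroup[OF cl1_refl[OF that]] by blast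
  qed
  then show ?thesis
    using auto_hom auto_ext St_auto[OF \<phi>] by (simp add: endos_def)
qed

lemma subgroup_St: "subgroup (St \<Gamma>) (Aut_pc \<Gamma>)"
proof (rule Aut.subgroupI)
  show "St \<Gamma> \<subseteq> carrier (Aut_pc \<Gamma>)" by (auto simp: carrier_Aut St_auto)
  show "St \<Gamma> \<noteq> {}"
    using endos_bij_St[OF ide_endos ide_endos] Id_compose[of ide "carrier G"]
    by (simp add: restrict_extensional) blast
next
  fix \<phi> \<psi> assume *: "\<phi> \<in> St \<Gamma>" "\<psi> \<in> St \<Gamma>"
  have "comp \<phi> \<psi> ` gen_subgroup \<Gamma> Y = gen_subgroup \<Gamma> Y" if Y: "Y \<in> closed_sets \<Gamma>" for Y
  proof -
    have "gen_subgroup \<Gamma> Y \<subseteq> carrier G" using gen_subgroup_closed Y by (auto simp: closed_sets_def)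
    then have "comp \<phi> \<psi> ` gen_subgroup \<Gamma> Y = \<phi> ` \<psi> ` gen_subgroup \<Gamma> Y"
      unfolding image_image compose_def by (intro image_cong) auto
    then show ?thesis using * Y by (simp add: St_def)
  qed
  then show "\<phi> \<otimes>\<^bsub>Aut_pc \<Gamma>\<^esub> \<psi> \<in> St \<Gamma>"
    using * Aut.m_closed[of \<phi> \<psi>] mult_Aut[of \<phi> \<psi>] by (simp add: carrier_Aut St_def)
next
  fix \<phi> assume \<phi>: "\<phi> \<in> St \<Gamma>"
  let ?\<psi> = "inv\<^bsub>Aut_pc \<Gamma>\<^esub> \<phi>"
  have auts: "\<phi> \<in> auto G" "?\<psi> \<in> auto G"
    using St_auto[OF \<phi>] Aut.inv_closed[of \<phi>] by (simp_all add: carrier_Aut)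
  then have eq: "comp ?\<psi> \<phi> = ide"
    using Aut.l_inv[of \<phi>] mult_Aut[of ?\<psi> \<phi>] by (simp add: carrier_Aut one_Aut)
  have inv: "?\<psi> (\<phi> a) = a" if "a \<in> carrier G" for a
    using that fun_cong[OF eq, of a] by (simp add: compose_def)
  have "?\<psi> ` gen_subgroup \<Gamma> Y = gen_subgroup \<Gamma> Y" if Y: "Y \<in> closed_sets \<Gamma>" for Y
  proof -
    have "gen_subgroup \<Gamma> Y \<subseteq> carrier G" using gen_subgroup_closed Y by (auto simp: closed_sets_def)
    then have "?\<psi> ` \<phi> ` gen_subgroup \<Gamma> Y = (\<lambda>a. a) ` gen_subgroup \<Gamma> Y"
      unfolding image_image by (intro image_cong) (auto simp: inv)
    then show ?thesis using \<phi> Y by (simp add: St_def)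
  qed
  then show "?\<psi> \<in> St \<Gamma>" using auts by (simp add: St_def)
qed

lemma St_mult: "\<phi> \<in> St \<Gamma> \<Longrightarrow> \<psi> \<in> St \<Gamma> \<Longrightarrow> \<phi> \<otimes>\<^bsub>Aut_pc \<Gamma>\<^esub> \<psi> = comp \<phi> \<psi>"
  by (intro mult_Aut St_auto)

lemma St_inverse:
  assumes "\<phi> \<in> St \<Gamma>"
  obtains \<psi> where "\<psi> \<in> St \<Gamma>" "comp \<phi> \<psi> = ide" "comp \<psi> \<phi> = ide"
proof -
  let ?\<psi> = "inv\<^bsub>Aut_pc \<Gamma>\<^esub> \<phi>"
  have "?\<psi> \<in> St \<Gamma>" using subgroup_St assms by (rule subgroup.m_inv_closed)
  moreover have "comp \<phi> ?\<psi> = ide" "comp ?\<psi> \<phi> = ide"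
    using Aut.r_inv[of \<phi>] Aut.l_inv[of \<phi>] St_mult[OF assms calculation] St_mult[OF calculation assms]
      St_auto[OF assms] by (simp_all add: carrier_Aut one_Aut)
  ultimately show ?thesis by (rule that)
qed

lemma St_coef_inverse:
  assumes "\<phi> \<in> St \<Gamma>"
  obtains N where "supported N" "mat_eq (mat_times (coef \<phi>) N) mat_one" "mat_eq (mat_times N (coef \<phi>)) mat_one"
proof -
  obtain \<psi> where \<psi>: "\<psi> \<in> St \<Gamma>" "comp \<phi> \<psi> = ide" "comp \<psi> \<phi> = ide" by (rule St_inverse[OF assms])
  note e = St_endos[OF assms] St_endos[OF \<psi>(1)]
  have "mat_eq (mat_times (coef \<phi>) (coef \<psi>)) mat_one" "mat_eq (mat_times (coef \<psi>) (coef \<phi>)) mat_one"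
    using mat_eq_coef_comp[OF e] mat_eq_coef_comp[OF e(2,1)] mat_eq_coef_ide \<psi> by (auto simp: mat_eq_def)
  with supported_coef[OF e(2)] show ?thesis by (rule that)
qed

text \<open>The inverse matrix has to be supported too, so that \<open>endo_of N\<close> is an
  endomorphism with matrix \<open>N\<close>. For integral points of the algebraic group this is
  supplied by \<open>pattern_inverse\<close>.\<close>

lemma endo_of_St:
  assumes "supported M" "supported N" "mat_eq (mat_times M N) mat_one" "mat_eq (mat_times N M) mat_one"
  shows "endo_of M \<in> St \<Gamma>"
proof (rule endos_bij_St[OF endo_of(1)[OF assms(1)] endo_of(1)[OF assms(2)]])
  show "comp (endo_of M) (endo_of N) = ide"
    using endo_of_mat_times[OF assms(1,2)] endo_of_cong[OF supported_mat_times[OF assms(1,2)] assms(3)] endo_of_mat_one by simp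
  show "comp (endo_of N) (endo_of M) = ide"
    using endo_of_mat_times[OF assms(2,1)] endo_of_cong[OF supported_mat_times[OF assms(2,1)] assms(4)] endo_of_mat_one by simp
qed

section \<open>Generation of the stabiliser\<close>

definition gens :: "('a word set \<Rightarrow> 'a word set) set" where
  "gens = J_auts \<Gamma> \<union> V_perp \<Gamma> \<union> Tr_perp \<Gamma>"

abbreviation K where "K \<equiv> generate (Aut_pc \<Gamma>) gens"

text \<open>For the proposed generators a preimage of each vertex inside the subgroup of its own
  closure is at hand, so surjectivity is asked for in that form. General closed sets follow, as they
  contain the closures of their vertices.\<close>

lemma auto_StI:
  assumes \<phi>: "\<phi> \<in> auto G"
    and into: "\<And>x. x \<in> X \<Longrightarrow> \<phi> (g x) \<in> gen_subgroup \<Gamma> (cl1 x)"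
    and onto: "\<And>x. x \<in> X \<Longrightarrow> g x \<in> \<phi> ` gen_subgroup \<Gamma> (cl1 x)"
  shows "\<phi> \<in> St \<Gamma>"
proof -
  interpret h: group_hom G G \<phi> using auto_hom[OF \<phi>] by unfold_locales
  have "\<phi> ` gen_subgroup \<Gamma> Y = gen_subgroup \<Gamma> Y" if Y: "Y \<in> closed_sets \<Gamma>" for Y
  proof
    have YX: "Y \<subseteq> X" using Y by (simp add: closed_sets_def)
    have mono: "gen_subgroup \<Gamma> (cl1 x) \<subseteq> gen_subgroup \<Gamma> Y" if "x \<in> Y" for x
      using cl1_subset_closed[OF Y that] by (rule gen_subgroup_mono)
    show "\<phi> ` gen_subgroup \<Gamma> Y \<subseteq> gen_subgroup \<Gamma> Y"
      by (rule hom_image_gen_subgroup[OF auto_hom[OF \<phi>] YX YX]) (use into mono YX in blast)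
    have "subgroup (\<phi> ` gen_subgroup \<Gamma> Y) G"
      by (rule h.subgroup_img_is_subgroup[OF gen_subgroup_subgroup[OF YX]])
    moreover have "g ` Y \<subseteq> \<phi> ` gen_subgroup \<Gamma> Y"
      using onto mono YX by blast
    ultimately show "gen_subgroup \<Gamma> Y \<subseteq> \<phi> ` gen_subgroup \<Gamma> Y"
      unfolding gen_subgroup_def[of \<Gamma> Y] by (intro G.generate_subgroup_incl)
  qed
  with \<phi> show ?thesis by (simp add: St_def)
qed

lemma J_St: "J_auts \<Gamma> \<subseteq> St \<Gamma>"
proof
  fix \<phi> assume J: "\<phi> \<in> J_auts \<Gamma>"
  then have \<phi>: "\<phi> \<in> auto G" by (simp add: J_auts_def)
  interpret h: group_hom G G \<phi> using auto_hom[OF \<phi>] by unfold_locales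
  show "\<phi> \<in> St \<Gamma>"
  proof (rule auto_StI[OF \<phi>])
    fix x assume x: "x \<in> X"
    interpret S: subgroup "gen_subgroup \<Gamma> (cl1 x)" G by (rule gen_subgroup_subgroup[OF cl_subset])
    have gx: "g x \<in> gen_subgroup \<Gamma> (cl1 x)" by (rule gen_in_gen_subgroup[OF cl1_refl[OF x]])
    have *: "\<phi> (g x) = g x \<or> \<phi> (g x) = inv\<^bsub>G\<^esub> g x" using J x by (simp add: J_auts_def)
    then show "\<phi> (g x) \<in> gen_subgroup \<Gamma> (cl1 x)"
      using gx S.m_inv_closed[OF gx] by (metis (full_types))
    have "\<phi> (g x) = g x \<or> \<phi> (inv\<^bsub>G\<^esub> g x) = g x"
      using * gen_closed[OF x] by (metis h.hom_inv G.inv_inv)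
    then show "g x \<in> \<phi> ` gen_subgroup \<Gamma> (cl1 x)"
      using gx S.m_inv_closed[OF gx] by (metis image_eqI)
  qed
qed

lemma class_auts_St:
  assumes "x0 \<in> X"
  shows "class_auts \<Gamma> x0 \<subseteq> St \<Gamma>"
proof
  let ?c = "perp_class \<Gamma> x0"
  fix \<phi> assume "\<phi> \<in> class_auts \<Gamma> x0"
  then obtain \<psi> where \<phi>: "\<phi> \<in> auto G"
    and \<psi>: "\<psi> \<in> auto (G\<lparr>carrier := gen_subgroup \<Gamma> ?c\<rparr>)"
    and eq: "\<And>a. a \<in> gen_subgroup \<Gamma> ?c \<Longrightarrow> \<phi> a = \<psi> a"
    and fixd: "\<And>z. z \<in> X - ?c \<Longrightarrow> \<phi> (g z) = g z"
    unfolding class_auts_def by blast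
  have "\<psi> ` gen_subgroup \<Gamma> ?c = gen_subgroup \<Gamma> ?c"
    using \<psi> by (simp add: auto_def Bij_def bij_betw_def)
  then have img: "\<phi> ` gen_subgroup \<Gamma> ?c = gen_subgroup \<Gamma> ?c"
    using eq by (simp cong: image_cong)
  \<comment> \<open>Equivalent vertices have the same closure, so G([x0]) lies in G(cl(x)) for every
    member x of the class.\<close>
  have sub: "?c \<subseteq> cl1 x" if "x \<in> ?c" for x
  proof
    fix y assume "y \<in> ?c"
    with that show "y \<in> cl1 x"
      using perp_class_iff[OF assms, of x] perp_class_iff[OF assms, of y] cl1_trans[of x x0 y] cl1_X[of x x0]
      by simp
  qed
  show "\<phi> \<in> St \<Gamma>"
  proof (rule auto_StI[OF \<phi>])
    fix x assume x: "x \<in> X"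
    have gx: "g x \<in> gen_subgroup \<Gamma> (cl1 x)" by (rule gen_in_gen_subgroup[OF cl1_refl[OF x]])
    show "\<phi> (g x) \<in> gen_subgroup \<Gamma> (cl1 x)"
    proof (cases "x \<in> ?c")
      case True
      then show ?thesis
        using img gen_in_gen_subgroup[OF True] gen_subgroup_mono[OF sub[OF True]] by blast
    qed (use fixd x gx in simp)
    show "g x \<in> \<phi> ` gen_subgroup \<Gamma> (cl1 x)"
    proof (cases "x \<in> ?c")
      case True
      then show ?thesis
        using img gen_in_gen_subgroup[OF True] gen_subgroup_mono[OF sub[OF True]] by blast
    next
      case False
      then show ?thesis using fixd[of x] x gx by (metis DiffI image_eqI)
    qed
  qed
qed

lemma V_perp_St: "V_perp \<Gamma> \<subseteq> St \<Gamma>"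
  unfolding V_perp_def
  by (rule Aut.generate_subgroup_incl[OF _ subgroup_St]) (use class_auts_St in blast)

lemma Tr_perp_St: "Tr_perp \<Gamma> \<subseteq> St \<Gamma>"
proof
  fix \<phi> assume "\<phi> \<in> Tr_perp \<Gamma>"
  then obtain x y where tr: "is_tr \<Gamma> x y \<phi>" and cl: "cl1 y \<subseteq> cl1 x"
    unfolding Tr_perp_def by blast
  then have xy: "x \<in> X" "y \<in> X" "x \<noteq> y" and \<phi>: "\<phi> \<in> auto G"
    and \<phi>x: "\<phi> (g x) = g x \<otimes>\<^bsub>G\<^esub> g y" and fixd: "\<And>z. z \<in> X - {x} \<Longrightarrow> \<phi> (g z) = g z"
    by (auto simp: is_tr_def)
  have y: "y \<in> cl1 x" using cl cl1_subset_iff[OF xy(1,2)] by simp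
  interpret h: group_hom G G \<phi> using auto_hom[OF \<phi>] by unfold_locales
  interpret S: subgroup "gen_subgroup \<Gamma> (cl1 x)" G by (rule gen_subgroup_subgroup[OF cl_subset])
  have gx: "g z \<in> gen_subgroup \<Gamma> (cl1 z)" if "z \<in> X" for z
    by (rule gen_in_gen_subgroup[OF cl1_refl[OF that]])
  have gy: "g y \<in> gen_subgroup \<Gamma> (cl1 x)" by (rule gen_in_gen_subgroup[OF y])
  show "\<phi> \<in> St \<Gamma>"
  proof (rule auto_StI[OF \<phi>])
    fix z assume z: "z \<in> X"
    show "\<phi> (g z) \<in> gen_subgroup \<Gamma> (cl1 z)"
      using fixd[of z] gx[OF z] \<phi>x gy z S.m_closed[of "g x" "g y"] by (cases "z = x") simp_all
    show "g z \<in> \<phi> ` gen_subgroup \<Gamma> (cl1 z)"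
    proof (cases "z = x")
      case True
      have "\<phi> (g x \<otimes>\<^bsub>G\<^esub> inv\<^bsub>G\<^esub> g y) = g x"
        using \<phi>x fixd[of y] xy gen_closed by (simp add: G.m_assoc)
      moreover have "g x \<otimes>\<^bsub>G\<^esub> inv\<^bsub>G\<^esub> g y \<in> gen_subgroup \<Gamma> (cl1 x)"
        using gx[OF xy(1)] gy by simp
      ultimately show ?thesis using True by (metis image_eqI)
    next
      case False
      then show ?thesis using fixd[of z] z gx[OF z] by (metis DiffI image_eqI singletonD)
    qed
  qed
qed

lemma gens_St: "gens \<subseteq> St \<Gamma>"
  unfolding gens_def using J_St V_perp_St Tr_perp_St by simp

lemma K_St: "K \<subseteq> St \<Gamma>"
  by (rule Aut.generate_subgroup_incl[OF gens_St subgroup_St])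

lemma endo_of_mat_times_K:
  assumes "supported M" "supported N" "endo_of M \<in> K" "endo_of N \<in> K"
  shows "endo_of (mat_times M N) \<in> K"
proof -
  have "endo_of M \<otimes>\<^bsub>Aut_pc \<Gamma>\<^esub> endo_of N \<in> K" using assms(3,4) by (rule generate.eng)
  then show ?thesis
    using St_mult[OF subsetD[OF K_St assms(3)] subsetD[OF K_St assms(4)]] endo_of_mat_times[OF assms(1,2)]
    by simp
qed

lemma ide_K: "ide \<in> K"
  using generate.one[of "Aut_pc \<Gamma>"] by (simp add: one_Aut)

section \<open>Elementary matrices and transvections\<close>

definition transvection_mat :: "'a \<Rightarrow> 'a \<Rightarrow> int \<Rightarrow> 'a \<Rightarrow> 'a \<Rightarrow> int" where
  "transvection_mat y x k z w = mat_one z w + (if z = y \<and> w = x then k else 0)"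

lemma mat_times_transvection_mat:
  assumes "y \<in> X" "w \<in> X"
  shows "mat_times M (transvection_mat y x k) z w = M z w + (if w = x then k * M z y else 0)"
proof -
  have "mat_times M (transvection_mat y x k) z w = (\<Sum>u\<in>X. (if u = w then M z w else 0) + (if u = y then (if w = x then k * M z y else 0) else 0))"
    unfolding mat_times_def transvection_mat_def mat_one_def by (rule sum.cong) (auto simp: algebra_simps)
  then show ?thesis using assms by (simp add: sum.distrib)
qed

lemma supported_transvection_mat: "x \<in> X \<Longrightarrow> y \<in> cl1 x \<Longrightarrow> supported (transvection_mat y x k)"
  using supported_mat_one by (auto simp: supported_def transvection_mat_def)

lemma transvection_mat_add: "x \<in> X \<Longrightarrow> y \<in> X \<Longrightarrow> y \<noteq> x \<Longrightarrow> mat_eq (mat_times (transvection_mat y x k) (transvection_mat y x l)) (transvection_mat y x (k + l))"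
  by (rule mat_eqI) (auto simp: mat_times_transvection_mat, auto simp: transvection_mat_def mat_one_def)

lemma transvection_mat_0: "mat_eq (transvection_mat y x 0) mat_one"
  by (simp add: mat_eq_def transvection_mat_def)

text \<open>The strict part of the preorder; for vertices it says that \<open>cl1 y\<close> is a
  proper subset of \<open>cl1 x\<close>, the condition in \<open>Tr_perp\<close>.\<close>

definition strict :: "'a \<Rightarrow> 'a \<Rightarrow> bool" where
  "strict y x \<longleftrightarrow> x \<in> X \<and> y \<in> cl1 x \<and> x \<notin> cl1 y"

lemma strictD: "strict y x \<Longrightarrow> x \<in> X \<and> y \<in> X \<and> y \<noteq> x \<and> y \<in> cl1 x \<and> x \<notin> cl1 y"
  using cl1_X cl1_refl by (auto simp: strict_def)

lemma endo_of_transvection_mat_comp: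
  assumes "strict y x"
  shows "comp (endo_of (transvection_mat y x k)) (endo_of (transvection_mat y x l)) = endo_of (transvection_mat y x (k + l))"
  using strictD[OF assms] endo_of_mat_times[OF supported_transvection_mat supported_transvection_mat] endo_of_cong[OF supported_mat_times[OF supported_transvection_mat supported_transvection_mat] transvection_mat_add] by simp

lemma endo_of_transvection_mat_0: "strict y x \<Longrightarrow> endo_of (transvection_mat y x 0) = ide"
  using endo_of_cong[OF supported_transvection_mat transvection_mat_0, of x y] strictD endo_of_mat_one by simp

lemma endo_of_transvection_mat_St:
  assumes "strict y x"
  shows "endo_of (transvection_mat y x k) \<in> St \<Gamma>"
  by (rule endos_bij_St[of _ "endo_of (transvection_mat y x (- k))"])
    (use assms strictD[OF assms] endo_of(1) supported_transvection_mat endo_of_transvection_mat_comp endo_of_transvection_mat_0 in simp_all)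

lemma endo_of_gen:
  assumes "supported M" "x \<in> X" "a \<in> gen_subgroup \<Gamma> (cl1 x)" "\<And>z. z \<in> cl1 x \<Longrightarrow> M z x = expo z a"
  shows "endo_of M (g x) = a"
  by (rule clique_expo_eqI[OF clique_cl1[OF assms(2)] endos_gen[OF endo_of(1)[OF assms(1)] assms(2)] assms(3)])
    (use mat_eqD[OF endo_of(2)[OF assms(1)] assms(2)] cl1_X assms(4) in \<open>simp add: coef_def\<close>)

lemma endo_of_transvection_mat_Tr:
  assumes "strict y x"
  shows "endo_of (transvection_mat y x 1) \<in> Tr_perp \<Gamma>"
proof -
  note s = strictD[OF assms]
  have supported: "supported (transvection_mat y x 1)" using s supported_transvection_mat by simp
  interpret S: subgroup "gen_subgroup \<Gamma> (cl1 x)" G by (rule gen_subgroup_subgroup[OF cl_subset])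
  have "endo_of (transvection_mat y x 1) (g x) = g x \<otimes>\<^bsub>G\<^esub> g y"
  proof (rule endo_of_gen[OF supported])
    show "g x \<otimes>\<^bsub>G\<^esub> g y \<in> gen_subgroup \<Gamma> (cl1 x)"
      using s gen_in_gen_subgroup cl1_refl by (intro S.m_closed) auto
  qed (use s gen_closed in \<open>auto simp: expo_mult expo transvection_mat_def mat_one_def\<close>)
  moreover have "endo_of (transvection_mat y x 1) (g z) = g z" if "z \<in> X - {x}" for z
    by (rule endo_of_gen[OF supported]) (use that gen_in_gen_subgroup[OF cl1_refl] in \<open>auto simp: expo transvection_mat_def mat_one_def\<close>)
  \<comment> \<open>By \<open>in_cl1_iff\<close>, \<open>y \<in> cl1 x\<close> means that x^perp is
    contained in y^perp, which gives the side condition of \<open>is_tr\<close>.\<close>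
  ultimately have "is_tr \<Gamma> x y (endo_of (transvection_mat y x 1))"
    unfolding is_tr_def using s in_cl1_iff[of x y] St_auto[OF endo_of_transvection_mat_St[OF assms]] by auto
  moreover have "cl1 y \<subset> cl1 x"
    using s cl1_subset_iff[of x y] cl1_subset_iff[of y x] by blast
  ultimately show ?thesis unfolding Tr_perp_def by blast
qed

text \<open>Elementary matrices at a fixed place multiply by adding their parameters, so
  \<open>k\<close> is reached from 0 in steps of 1 and -1, that is, by the transvection and its
  inverse.\<close>

lemma endo_of_transvection_mat_K:
  assumes "strict y x"
  shows "endo_of (transvection_mat y x k) \<in> K"
proof -
  note St = endo_of_transvection_mat_St[OF assms]
  have 1: "endo_of (transvection_mat y x 1) \<in> gens" using endo_of_transvection_mat_Tr[OF assms] by (simp add: gens_def)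
  have "inv\<^bsub>Aut_pc \<Gamma>\<^esub> endo_of (transvection_mat y x 1) = endo_of (transvection_mat y x (-1))"
    by (rule Aut.inv_equality)
      (simp_all add: carrier_Aut St_auto St_mult St endo_of_transvection_mat_comp endo_of_transvection_mat_0 one_Aut assms)
  then have m1: "endo_of (transvection_mat y x (-1)) \<in> K" using generate.inv[OF 1, of "Aut_pc \<Gamma>"] by simp
  have step: "endo_of (transvection_mat y x (k + l)) \<in> K" if "endo_of (transvection_mat y x k) \<in> K" "endo_of (transvection_mat y x l) \<in> K" for k l
    using generate.eng[OF that] St_mult[OF St St, of k l] endo_of_transvection_mat_comp[OF assms] by simp
  show ?thesis
  proof (induction k rule: int_induct[where k = 0])
    case base
    show ?case unfolding endo_of_transvection_mat_0[OF assms] by (rule ide_K)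
  next
    case (step1 k)
    then show ?case using step[OF _ generate.incl[OF 1]] by simp
  next
    case (step2 k)
    then show ?case using step[OF _ m1, of k] by simp
  qed
qed

text \<open>The support \<open>R\<close> is kept apart from the entries \<open>u\<close>, so that an
  induction can remove places one by one without changing the remaining entries.\<close>

definition unipotent_mat :: "('a \<Rightarrow> 'a \<Rightarrow> int) \<Rightarrow> ('a \<times> 'a) set \<Rightarrow> 'a \<Rightarrow> 'a \<Rightarrow> int" where
  "unipotent_mat u R z w = mat_one z w + (if (z, w) \<in> R then u z w else 0)"

lemma supported_unipotent_mat: "(\<And>y x. (y, x) \<in> R \<Longrightarrow> strict y x) \<Longrightarrow> supported (unipotent_mat u R)"
  using supported_mat_one strictD by (fastforce simp: supported_def unipotent_mat_def)

text \<open>A pair \<open>(y, x)\<close> with \<open>cl(x)\<close> of least size is split off on the right. Column \<open>y\<close> of the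
  remaining factor is then trivial, so the elementary matrix contributes only its own entry.\<close>

lemma endo_of_unipotent_mat_K:
  assumes "finite R" "\<And>y x. (y, x) \<in> R \<Longrightarrow> strict y x"
  shows "endo_of (unipotent_mat u R) \<in> K"
  using assms
proof (induction rule: finite_psubset_induct)
  case (psubset R)
  show ?case
  proof (cases "R = {}")
    case True
    have "mat_eq (unipotent_mat u {}) mat_one" by (simp add: mat_eq_def unipotent_mat_def)
    then have "endo_of (unipotent_mat u {}) = ide" using endo_of_cong[OF supported_unipotent_mat, of "{}" u mat_one] endo_of_mat_one by simp
    then show ?thesis using True ide_K by metis
  next
    case False
    then obtain p0 where "p0 \<in> R" by blast
    from ex_has_least_nat[of "\<lambda>p. p \<in> R", OF this, of "\<lambda>p. card (cl1 (snd p))"]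
    obtain y x where yx: "(y, x) \<in> R" and least: "\<And>q. q \<in> R \<Longrightarrow> card (cl1 x) \<le> card (cl1 (snd q))"
      by auto
    note s = strictD[OF psubset.prems[OF yx]]
    have "cl1 y \<subset> cl1 x"
      using s cl1_subset_iff[of x y] cl1_subset_iff[of y x] by blast
    then have "card (cl1 y) < card (cl1 x)"
      by (intro psubset_card_mono finite_subset[OF cl_subset finite_X])
    then have noty: "(z, y) \<notin> R" for z using least[of "(z, y)"] by auto
    let ?R = "R - {(y, x)}"
    have IH: "endo_of (unipotent_mat u ?R) \<in> K"
      by (rule psubset.IH) (use yx psubset.prems in auto)
    have supported: "supported (unipotent_mat u ?R)" "supported (transvection_mat y x (u y x))"
      using supported_unipotent_mat[of ?R u] psubset.prems supported_transvection_mat s by auto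
    have "mat_eq (mat_times (unipotent_mat u ?R) (transvection_mat y x (u y x))) (unipotent_mat u R)"
    proof (rule mat_eqI)
      fix w z assume "w \<in> X" "z \<in> X"
      moreover have "unipotent_mat u ?R z y = mat_one z y" using noty by (simp add: unipotent_mat_def)
      ultimately show "mat_times (unipotent_mat u ?R) (transvection_mat y x (u y x)) z w = unipotent_mat u R z w"
        using s yx by (simp add: mat_times_transvection_mat) (auto simp: unipotent_mat_def mat_one_def)
    qed
    from endo_of_cong[OF supported_mat_times[OF supported] this] endo_of_mat_times_K[OF supported IH endo_of_transvection_mat_K[OF psubset.prems[OF yx]]]
    show ?thesis by simp
  qed
qed

section \<open>Diagonal blocks over the equivalence classes\<close>

definition eqv :: "'a \<Rightarrow> 'a \<Rightarrow> bool" where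
  "eqv z w \<longleftrightarrow> z \<in> cl1 w \<and> w \<in> cl1 z"

lemma eqv_refl: "x \<in> X \<Longrightarrow> eqv x x"
  by (simp add: eqv_def cl1_refl)

lemma eqv_sym: "eqv x y \<Longrightarrow> eqv y x"
  by (simp add: eqv_def)

lemma eqv_X: "eqv x y \<Longrightarrow> x \<in> X \<and> y \<in> X"
  using cl1_X by (auto simp: eqv_def)

lemma eqv_trans: "eqv x y \<Longrightarrow> eqv y z \<Longrightarrow> eqv x z"
  using eqv_X[of x y] eqv_X[of y z] cl1_trans[of z y x] cl1_trans[of x y z] by (simp add: eqv_def)

text \<open>Convexity of the classes in the preorder, on which the multiplicativity of diagonal
  blocks depends.\<close>

lemma eqv_between: "w \<in> X \<Longrightarrow> u \<in> X \<Longrightarrow> z \<in> X \<Longrightarrow> z \<in> cl1 u \<Longrightarrow> u \<in> cl1 w \<Longrightarrow> eqv z w \<Longrightarrow> eqv u w"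
  using cl1_trans[of u z w] by (simp add: eqv_def)

text \<open>\<open>S = X\<close> gives the whole block-diagonal factor, a single class gives one of
  its blocks, and the sets in between serve the induction on \<open>S\<close>. Identity columns keep
  all of them the same size.\<close>

definition block_mat :: "('a \<Rightarrow> 'a \<Rightarrow> int) \<Rightarrow> 'a set \<Rightarrow> 'a \<Rightarrow> 'a \<Rightarrow> int" where
  "block_mat M S z w = (if w \<in> S then (if eqv z w then M z w else 0) else mat_one z w)"

definition saturated :: "'a set \<Rightarrow> bool" where
  "saturated S \<longleftrightarrow> S \<subseteq> X \<and> (\<forall>w\<in>S. \<forall>z. eqv z w \<longrightarrow> z \<in> S)"

lemma supported_block_mat: "supported (block_mat M S)"
  using supported_mat_one by (auto simp: supported_def block_mat_def eqv_def)

lemma mat_times_mat_one_col: "w \<in> X \<Longrightarrow> (\<Sum>u\<in>X. f u * mat_one u w) = f w"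
  by (simp add: mat_one_def if_distrib[of "\<lambda>t. _ * t"] sum.delta cong: if_cong)

lemma mat_times_mat_one_row: "z \<in> X \<Longrightarrow> (\<Sum>u\<in>X. mat_one z u * f u) = f z"
  by (simp add: mat_one_def if_distrib[of "\<lambda>t. t * _"] if_distribR sum.delta' cong: if_cong)

text \<open>If \<open>z\<close> and \<open>w\<close> are equivalent, a nonzero term
  \<open>M z u * N u w\<close> puts \<open>u\<close> between them and hence into their class, so the
  full product never leaves the block. In particular the blocks of an inverse are inverse to the
  blocks.\<close>

lemma block_mat_mat_times:
  assumes "saturated S" "supported M" "supported N"
  shows "mat_eq (mat_times (block_mat M S) (block_mat N S)) (block_mat (mat_times M N) S)"
proof (rule mat_eqI)
  fix w z assume w: "w \<in> X" and z: "z \<in> X"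
  show "mat_times (block_mat M S) (block_mat N S) z w = block_mat (mat_times M N) S z w"
  proof (cases "w \<in> S")
    case False
    have "mat_times (block_mat M S) (block_mat N S) z w = (\<Sum>u\<in>X. block_mat M S z u * mat_one u w)"
      unfolding mat_times_def using False by (simp add: block_mat_def[of N])
    then show ?thesis using False mat_times_mat_one_col[OF w] by (simp add: block_mat_def)
  next
    case True
    have "block_mat M S z u * block_mat N S u w = (if eqv z w then M z u * N u w else 0)" if u: "u \<in> X" for u
    proof (cases "eqv u w")
      case uw: True
      then have "u \<in> S" using assms(1) True unfolding saturated_def by blast
      moreover have "eqv z u \<longleftrightarrow> eqv z w"
        using uw eqv_trans[of z u w] eqv_trans[of z w u] eqv_sym[of u w] by auto
      ultimately show ?thesis using uw True by (simp add: block_mat_def)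
    next
      case uw: False
      have "M z u * N u w = 0" if "eqv z w"
        using supportedD[OF assms(2) u z] supportedD[OF assms(3) w u] eqv_between[OF w u z _ _ that] uw by auto
      then show ?thesis using uw True by (simp add: block_mat_def)
    qed
    then have "mat_times (block_mat M S) (block_mat N S) z w = (\<Sum>u\<in>X. if eqv z w then M z u * N u w else 0)"
      unfolding mat_times_def by (intro sum.cong) auto
    then show ?thesis using True by (simp add: block_mat_def mat_times_def)
  qed
qed

text \<open>For \<open>w\<close> in \<open>T\<close>, column \<open>w\<close> of the right factor is
  supported in \<open>T\<close>, where the left factor has only identity columns. For other
  \<open>w\<close> the right factor has an identity column and the left factor survives.\<close>

lemma block_mat_union:
  assumes "saturated S" "saturated T" "S \<inter> T = {}"
  shows "mat_eq (mat_times (block_mat M S) (block_mat M T)) (block_mat M (S \<union> T))"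
proof (rule mat_eqI)
  fix w z assume w: "w \<in> X" and z: "z \<in> X"
  show "mat_times (block_mat M S) (block_mat M T) z w = block_mat M (S \<union> T) z w"
  proof (cases "w \<in> T")
    case False
    have "mat_times (block_mat M S) (block_mat M T) z w = (\<Sum>u\<in>X. block_mat M S z u * mat_one u w)"
      unfolding mat_times_def using False by (simp add: block_mat_def[of M T])
    then show ?thesis using False mat_times_mat_one_col[OF w] by (simp add: block_mat_def)
  next
    case True
    have "block_mat M S z u * block_mat M T u w = mat_one z u * block_mat M T u w" for u
    proof (cases "eqv u w")
      case uw: True
      then have "u \<notin> S" using assms True unfolding saturated_def by blast
      then show ?thesis by (simp add: block_mat_def)
    qed (use True in \<open>simp add: block_mat_def\<close>)
    then have "mat_times (block_mat M S) (block_mat M T) z w = (\<Sum>u\<in>X. mat_one z u * block_mat M T u w)"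
      unfolding mat_times_def by (intro sum.cong) auto
    then show ?thesis using True mat_times_mat_one_row[OF z] by (simp add: block_mat_def)
  qed
qed

lemma block_mat_mat_one: "mat_eq M mat_one \<Longrightarrow> mat_eq (block_mat M S) mat_one"
  using eqv_refl by (auto simp: mat_eq_def block_mat_def mat_one_def)

lemma perp_class_eqv: "x \<in> X \<Longrightarrow> y \<in> perp_class \<Gamma> x \<longleftrightarrow> eqv y x"
  by (simp add: perp_class_iff eqv_def)

lemma saturated_perp_class: "x \<in> X \<Longrightarrow> saturated (perp_class \<Gamma> x)"
  unfolding saturated_def using eqv_X[of _ x] eqv_trans[of _ _ x] by (auto simp: perp_class_eqv)

text \<open>Some element of G(P) has the same exponents as \<open>a\<close>, and exponents are
  faithful on the larger clique.\<close>

lemma clique_gen_subgroup_reduce: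
  assumes "clique Q" "P \<subseteq> Q" "a \<in> gen_subgroup \<Gamma> Q" "\<And>y. y \<in> Q - P \<Longrightarrow> expo y a = 0"
  shows "a \<in> gen_subgroup \<Gamma> P"
proof -
  have P: "P \<subseteq> X" using assms(1,2) by (auto simp: clique_def)
  obtain b where b: "b \<in> gen_subgroup \<Gamma> P" "\<forall>y\<in>P. expo y b = expo y a"
    using expo_realize[OF P, of "\<lambda>y. expo y a"] by blast
  have "a = b"
  proof (rule clique_expo_eqI[OF assms(1,3)])
    show "b \<in> gen_subgroup \<Gamma> Q" using b(1) gen_subgroup_mono[OF assms(2)] by blast
    show "expo y a = expo y b" if "y \<in> Q" for y
      using that b assms(4) expo_outside[OF P b(1)] by (cases "y \<in> P") simp_all
  qed
  with b show ?thesis by simp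
qed

text \<open>The block of the inverse inverts the block. A class of at least two vertices thus gives
  an automorphism of G([x]) extended by the identity, an element of \<open>V_perp\<close>. A
  singleton class gives an invertible integer, so 1 or -1, and an element of
  \<open>J_auts\<close>.\<close>

lemma endo_of_block_mat_perp_class:
  assumes x: "x \<in> X" and MN: "supported M" "supported N" "mat_eq (mat_times M N) mat_one" "mat_eq (mat_times N M) mat_one"
  shows "endo_of (block_mat M (perp_class \<Gamma> x)) \<in> gens"
proof -
  let ?c = "perp_class \<Gamma> x"
  let ?f = "endo_of (block_mat M ?c)" and ?h = "endo_of (block_mat N ?c)"
  have inv: "mat_eq (mat_times (block_mat M ?c) (block_mat N ?c)) mat_one" if "supported M" "supported N" "mat_eq (mat_times M N) mat_one" for M N
    using mat_eq_trans[OF block_mat_mat_times[OF saturated_perp_class[OF x] that(1,2)] block_mat_mat_one[OF that(3)]] .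
  note invs = inv[OF MN(1-3)] inv[OF MN(2,1,4)]
  have f: "?f \<in> auto G" by (rule St_auto[OF endo_of_St[OF supported_block_mat supported_block_mat invs]])
  have fh: "comp ?f ?h = ide" "comp ?h ?f = ide"
    using endo_of_mat_times[OF supported_block_mat supported_block_mat] endo_of_cong[OF supported_mat_times[OF supported_block_mat supported_block_mat]] invs endo_of_mat_one by simp_all
  have cX: "?c \<subseteq> X" using saturated_perp_class[OF x] by (simp add: saturated_def)
  have fixd: "?f (g z) = g z" if "z \<in> X - ?c" for z
    by (rule endo_of_gen[OF supported_block_mat])
      (use that gen_in_gen_subgroup[OF cl1_refl] in \<open>auto simp: expo block_mat_def mat_one_def\<close>)
  \<comment> \<open>Stated for every matrix, as it is applied both to the block of \<open>M\<close>
    and to that of its inverse \<open>N\<close>.\<close>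
  have into: "endo_of (block_mat M ?c) ` gen_subgroup \<Gamma> ?c \<subseteq> gen_subgroup \<Gamma> ?c" for M
  proof (rule hom_image_gen_subgroup[OF endos_hom[OF endo_of(1)[OF supported_block_mat]] cX cX])
    fix w assume w: "w \<in> ?c"
    then have wX: "w \<in> X" using cX by blast
    show "endo_of (block_mat M ?c) (g w) \<in> gen_subgroup \<Gamma> ?c"
    proof (rule clique_gen_subgroup_reduce[OF clique_cl1[OF wX] _ endos_gen[OF endo_of(1)[OF supported_block_mat] wX]])
      show "?c \<subseteq> cl1 w"
        using w eqv_trans[of _ x w] eqv_sym[of w x] by (auto simp: perp_class_eqv[OF x] eqv_def[of _ w])
      fix y assume y: "y \<in> cl1 w - ?c"
      then have "\<not> eqv y w" using w eqv_trans[of y w x] by (auto simp: perp_class_eqv[OF x])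
      then show "expo y (endo_of (block_mat M ?c) (g w)) = 0"
        using mat_eqD[OF endo_of(2)[OF supported_block_mat] wX cl1_X, of y w M ?c] y w by (simp add: coef_def block_mat_def)
    qed
  qed
  show ?thesis
  proof (cases "card ?c \<ge> 2")
    case True
    let ?GS = "gen_subgroup \<Gamma> ?c"
    have GS: "a \<in> ?GS \<Longrightarrow> a \<in> carrier G" for a using gen_subgroup_closed[OF cX] .
    have fh': "?f (?h a) = a" "?h (?f a) = a" if "a \<in> ?GS" for a
      using fun_cong[OF fh(1), of a] fun_cong[OF fh(2), of a] GS[OF that] by (simp_all add: compose_def)
    have "bij_betw ?f ?GS ?GS"
      by (rule bij_betw_byWitness[where f' = ?h]) (use fh' into in auto)
    \<comment> \<open>Membership in \<open>auto\<close> of the subgroup demands extensionality with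
      respect to the smaller carrier, hence the restriction.\<close>
    then have "bij_betw (restrict ?f ?GS) ?GS ?GS" by (simp add: bij_betw_restrict_eq)
    moreover have "restrict ?f ?GS \<in> hom (G\<lparr>carrier := ?GS\<rparr>) (G\<lparr>carrier := ?GS\<rparr>)"
      using into[of M] auto_hom[OF f] GS subgroup.m_closed[OF gen_subgroup_subgroup[OF cX]]
      by (auto simp: hom_def image_subset_iff)
    ultimately have "restrict ?f ?GS \<in> auto (G\<lparr>carrier := ?GS\<rparr>)"
      by (simp add: auto_def Bij_def)
    then have "?f \<in> class_auts \<Gamma> x"
      unfolding class_auts_def using f fixd by (auto intro!: bexI[of _ "restrict ?f ?GS"])
    then have "?f \<in> V_perp \<Gamma>" unfolding V_perp_def using x True by (auto intro!: generate.incl)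
    then show ?thesis by (simp add: gens_def)
  next
    case False
    have xc: "x \<in> ?c" using x eqv_refl by (simp add: perp_class_eqv)
    have c: "?c = {x}"
    proof -
      have "card ?c = 1" using False xc finite_subset[OF cX finite_X] card_gt_0_iff[of ?c] by fastforce
      then show ?thesis using xc by (metis card_1_singletonE singletonD)
    qed
    have col: "block_mat M ?c z x = (if z = x then M x x else 0)" for M z
    proof (cases "z = x")
      case False
      then have "\<not> eqv z x" using c perp_class_eqv[OF x, of z] by blast
      then show ?thesis using False xc by (simp add: block_mat_def)
    qed (use eqv_refl[OF x] xc in \<open>simp add: block_mat_def\<close>)
    have "mat_times (block_mat M ?c) (block_mat N ?c) x x = M x x * N x x"
      unfolding mat_times_def col using x by (simp add: if_distrib[of "\<lambda>t. _ * t"] col cong: if_cong)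
    then have "M x x * N x x = 1"
      using mat_eqD[OF invs(1) x x] by (simp add: mat_one_def)
    then have M: "M x x = 1 \<or> M x x = -1" using zmult_eq_1_iff by blast
    have gx: "g x \<in> gen_subgroup \<Gamma> (cl1 x)" by (rule gen_in_gen_subgroup[OF cl1_refl[OF x]])
    have "?f (g x) \<in> {g x, inv\<^bsub>G\<^esub> g x}"
      using M
    proof
      assume "M x x = 1"
      then have "?f (g x) = g x"
        by (intro endo_of_gen[OF supported_block_mat x gx]) (auto simp: col expo x)
      then show ?thesis by simp
    next
      assume "M x x = -1"
      then have "?f (g x) = inv\<^bsub>G\<^esub> g x"
        using subgroup.m_inv_closed[OF gen_subgroup_subgroup[OF cl_subset] gx]
        by (intro endo_of_gen[OF supported_block_mat x]) (auto simp: col expo x expo_inv gen_closed)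
      then show ?thesis by simp
    qed
    moreover have "?f (g z) = g z" if "z \<in> X" "z \<noteq> x" for z
      by (rule fixd) (use that c in simp)
    ultimately have "?f (g z) \<in> {g z, inv\<^bsub>G\<^esub> g z}" if "z \<in> X" for z
      using that by (cases "z = x") simp_all
    then have "?f \<in> J_auts \<Gamma>"
      unfolding J_auts_def using f by simp
    then show ?thesis by (simp add: gens_def)
  qed
qed

text \<open>Whole classes are removed one at a time: what remains is again saturated, and
  \<open>block_mat_union\<close> recombines the two factors.\<close>

lemma endo_of_block_mat_K:
  assumes MN: "supported M" "supported N" "mat_eq (mat_times M N) mat_one" "mat_eq (mat_times N M) mat_one" and "finite S" "saturated S"
  shows "endo_of (block_mat M S) \<in> K"
  using assms(5,6)
proof (induction rule: finite_psubset_induct)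
  case (psubset S)
  show ?case
  proof (cases "S = {}")
    case True
    have "mat_eq (block_mat M {}) mat_one" by (simp add: mat_eq_def block_mat_def)
    then have "endo_of (block_mat M {}) = ide" using endo_of_cong[OF supported_block_mat, of M "{}" mat_one] endo_of_mat_one by simp
    then show ?thesis using True ide_K by metis
  next
    case False
    then obtain x where xS: "x \<in> S" by blast
    then have x: "x \<in> X" using psubset.prems by (auto simp: saturated_def)
    let ?c = "perp_class \<Gamma> x"
    have sub: "?c \<subseteq> S" using xS psubset.prems perp_class_eqv[OF x] by (auto simp: saturated_def)
    have xc: "x \<in> ?c" using x eqv_refl by (simp add: perp_class_eqv)
    have sat: "saturated (S - ?c)"
      unfolding saturated_def
    proof (intro conjI ballI allI impI)
      show "S - ?c \<subseteq> X" using psubset.prems by (auto simp: saturated_def)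
      fix w z assume w: "w \<in> S - ?c" and zw: "eqv z w"
      then have "z \<in> S" using psubset.prems by (auto simp: saturated_def)
      moreover have "\<not> eqv z x"
        using w zw eqv_trans[OF eqv_sym[OF zw], of x] by (auto simp: perp_class_eqv[OF x])
      ultimately show "z \<in> S - ?c" by (simp add: perp_class_eqv[OF x])
    qed
    have "endo_of (block_mat M (S - ?c)) \<in> K"
      by (rule psubset.IH) (use sub xc sat in auto)
    moreover have "endo_of (block_mat M ?c) \<in> K"
      by (rule generate.incl[OF endo_of_block_mat_perp_class[OF x MN]])
    ultimately have "endo_of (mat_times (block_mat M (S - ?c)) (block_mat M ?c)) \<in> K"
      by (rule endo_of_mat_times_K[OF supported_block_mat supported_block_mat])
    moreover have "mat_eq (mat_times (block_mat M (S - ?c)) (block_mat M ?c)) (block_mat M (S - ?c \<union> ?c))"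
      by (rule block_mat_union[OF sat saturated_perp_class[OF x]]) blast
    moreover have "S - ?c \<union> ?c = S" using sub by blast
    ultimately show ?thesis using endo_of_cong[OF supported_mat_times[OF supported_block_mat supported_block_mat]] by metis
  qed
qed

lemma saturated_X: "saturated X"
  unfolding saturated_def using eqv_X by blast

text \<open>U is D' times the matrix of \<open>\<phi>\<close>, where D' consists of the blocks of
  the inverse matrix. The two inductions above put D and U into \<open>K\<close>, and
  \<open>\<phi>\<close> is recovered as their product.\<close>

lemma St_K: "St \<Gamma> \<subseteq> K"
proof
  fix \<phi> assume \<phi>: "\<phi> \<in> St \<Gamma>"
  let ?M = "coef \<phi>"
  obtain N where N: "supported N" "mat_eq (mat_times ?M N) mat_one" "mat_eq (mat_times N ?M) mat_one"
    by (rule St_coef_inverse[OF \<phi>])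
  have M: "supported ?M" by (rule supported_coef[OF St_endos[OF \<phi>]])
  let ?D = "block_mat ?M X" and ?D' = "block_mat N X"
  have D: "endo_of ?D \<in> K" by (rule endo_of_block_mat_K[OF M N finite_X saturated_X])
  have D'D: "mat_eq (mat_times ?D' ?D) mat_one" and DD': "mat_eq (mat_times ?D ?D') mat_one"
    using mat_eq_trans[OF block_mat_mat_times[OF saturated_X] block_mat_mat_one] M N by blast+
  have D'_St: "endo_of ?D' \<in> St \<Gamma>" by (rule endo_of_St[OF supported_block_mat supported_block_mat D'D DD'])
  let ?U = "mat_times ?D' ?M"
  let ?R = "{(z, w) \<in> X \<times> X. strict z w}"
  have U: "supported ?U" by (rule supported_mat_times[OF supported_block_mat M])
  have "mat_eq (unipotent_mat ?U ?R) ?U"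
  proof (rule mat_eqI)
    fix w z assume w: "w \<in> X" and z: "z \<in> X"
    consider "strict z w" | "eqv z w" | "z \<notin> cl1 w"
      using w by (auto simp: strict_def eqv_def)
    then show "unipotent_mat ?U ?R z w = ?U z w"
    proof cases
      case 1
      then show ?thesis using w z strictD[OF 1] by (simp add: unipotent_mat_def mat_one_def)
    next
      case 2
      \<comment> \<open>A nonzero \<open>?D' z u\<close> makes \<open>u\<close> equivalent to
        \<open>z\<close>, hence to \<open>w\<close>, and there the matrix agrees with its block
        part. So the diagonal blocks of U are those of \<open>D' D\<close>, the identity.\<close>
      have "?D' z u * ?M u w = ?D' z u * ?D u w" if u: "u \<in> X" for u
        using u w 2 eqv_trans[of u z w] eqv_sym[of z u] by (auto simp: block_mat_def)
      then have "?U z w = mat_times ?D' ?D z w" unfolding mat_times_def by (intro sum.cong) auto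
      also have "\<dots> = mat_one z w" by (rule mat_eqD[OF D'D w z])
      finally show ?thesis using 2 by (simp add: unipotent_mat_def strict_def eqv_def)
    next
      case 3
      then show ?thesis
        using supportedD[OF U w z] supportedD[OF supported_mat_one w z] by (simp add: unipotent_mat_def strict_def)
    qed
  qed
  moreover have "supported (unipotent_mat ?U ?R)" by (rule supported_unipotent_mat) auto
  ultimately have "endo_of ?U = endo_of (unipotent_mat ?U ?R)" using endo_of_cong by simp
  also have "\<dots> \<in> K"
    by (rule endo_of_unipotent_mat_K) (use finite_X in \<open>auto intro: finite_subset[of _ "X \<times> X"]\<close>)
  finally have UK: "endo_of ?U \<in> K" .
  have "comp (endo_of ?D') \<phi> = endo_of ?U"
    using endo_of_mat_times[OF supported_block_mat M, of N X] endo_of_coef[OF St_endos[OF \<phi>]] by simp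
  then have "endo_of ?D \<otimes>\<^bsub>Aut_pc \<Gamma>\<^esub> (endo_of ?D' \<otimes>\<^bsub>Aut_pc \<Gamma>\<^esub> \<phi>) \<in> K"
    using generate.eng[OF D UK] St_mult[OF D'_St \<phi>] by simp
  moreover have "endo_of ?D \<otimes>\<^bsub>Aut_pc \<Gamma>\<^esub> endo_of ?D' = \<one>\<^bsub>Aut_pc \<Gamma>\<^esub>"
    using St_mult[of "endo_of ?D" "endo_of ?D'"] D K_St D'_St endo_of_mat_times[OF supported_block_mat supported_block_mat]
      endo_of_cong[OF supported_mat_times[OF supported_block_mat supported_block_mat] DD'] endo_of_mat_one by (simp add: one_Aut subset_iff)
  moreover have "endo_of ?D \<in> carrier (Aut_pc \<Gamma>)" "endo_of ?D' \<in> carrier (Aut_pc \<Gamma>)" "\<phi> \<in> carrier (Aut_pc \<Gamma>)"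
    using D K_St D'_St \<phi> St_auto by (auto simp: carrier_Aut)
  ultimately show "\<phi> \<in> K"
    by (simp add: Aut.m_assoc[symmetric])
qed

theorem generate_St: "generate (Aut_pc \<Gamma>) (J_auts \<Gamma> \<union> V_perp \<Gamma> \<union> Tr_perp \<Gamma>) = St \<Gamma>"
  using K_St St_K unfolding gens_def by blast

end

section \<open>Functions that are polynomial over the rationals\<close>

definition monomial_eval :: "('v \<Rightarrow> complex) \<Rightarrow> ('v \<Rightarrow>\<^sub>0 nat) \<Rightarrow> complex" where
  "monomial_eval a m = (\<Prod>v\<in>Poly_Mapping.keys m. a v ^ Poly_Mapping.lookup m v)"

text \<open>Variables outside the support have exponent 0 and contribute the factor 1, so several
  monomials can be evaluated over one common finite set.\<close>

lemma monomial_eval_superset: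
  "finite F \<Longrightarrow> Poly_Mapping.keys m \<subseteq> F \<Longrightarrow> monomial_eval a m = (\<Prod>v\<in>F. a v ^ Poly_Mapping.lookup m v)"
  unfolding monomial_eval_def by (rule prod.mono_neutral_left) (auto simp: in_keys_iff)

lemma monomial_eval_add: "monomial_eval a (m + m') = monomial_eval a m * monomial_eval a m'"
proof -
  let ?F = "Poly_Mapping.keys m \<union> Poly_Mapping.keys m'"
  have "monomial_eval a k = (\<Prod>v\<in>?F. a v ^ Poly_Mapping.lookup k v)" if "k \<in> {m, m', m + m'}" for k
    using that keys_add[of m m'] by (intro monomial_eval_superset) auto
  then show ?thesis by (simp add: lookup_add power_add prod.distrib)
qed

lemma qpoly_eval_superset:
  assumes "finite F" "Poly_Mapping.keys p \<subseteq> F"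
  shows "qpoly_eval a p = (\<Sum>m\<in>F. of_rat (Poly_Mapping.lookup p m) * monomial_eval a m)"
  unfolding qpoly_eval_def monomial_eval_def[symmetric]
  by (rule sum.mono_neutral_left) (use assms in \<open>auto simp: in_keys_iff\<close>)

lemma qpoly_eval_add: "qpoly_eval a (p + q) = qpoly_eval a p + qpoly_eval a q"
proof -
  let ?F = "Poly_Mapping.keys p \<union> Poly_Mapping.keys q"
  have "qpoly_eval a k = (\<Sum>m\<in>?F. of_rat (Poly_Mapping.lookup k m) * monomial_eval a m)"
    if "k \<in> {p, q, p + q}" for k
    using that keys_add[of p q] by (intro qpoly_eval_superset) auto
  then show ?thesis by (simp add: lookup_add of_rat_add distrib_right sum.distrib)
qed

lemma qpoly_eval_single: "qpoly_eval a (Poly_Mapping.single m q) = of_rat q * monomial_eval a m"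
  by (simp add: qpoly_eval_def monomial_eval_def)

text \<open>The condition that \<open>Q_morphism\<close> puts on one coordinate. Closure under sums
  and products then replaces explicit polynomials for determinants and inverses.\<close>

definition rat_poly_on :: "'v set \<Rightarrow> ('s \<Rightarrow> 'v \<Rightarrow> complex) \<Rightarrow> 's set \<Rightarrow> ('s \<Rightarrow> complex) \<Rightarrow> bool" where
  "rat_poly_on V c S f \<longleftrightarrow> (\<exists>p. qpoly_vars p \<subseteq> V \<and> (\<forall>s\<in>S. f s = qpoly_eval (c s) p))"

lemma rat_poly_on_cong: "rat_poly_on V c S f \<Longrightarrow> (\<And>s. s \<in> S \<Longrightarrow> f' s = f s) \<Longrightarrow> rat_poly_on V c S f'"
  unfolding rat_poly_on_def by auto

lemma rat_poly_on_term:
  assumes "Poly_Mapping.keys m \<subseteq> V"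
  shows "rat_poly_on V c S (\<lambda>s. of_rat q * monomial_eval (c s) m)"
  unfolding rat_poly_on_def
  by (rule exI[of _ "Poly_Mapping.single m q"]) (use assms in \<open>auto simp: qpoly_eval_single qpoly_vars_def\<close>)

lemma rat_poly_on_const: "rat_poly_on V c S (\<lambda>s. of_rat q)"
  using rat_poly_on_term[of 0 V c S q] by (simp add: monomial_eval_def)

lemma rat_poly_on_var:
  assumes "v \<in> V"
  shows "rat_poly_on V c S (\<lambda>s. c s v)"
  using rat_poly_on_term[of "Poly_Mapping.single v 1" V c S 1] assms by (simp add: monomial_eval_def)

lemma rat_poly_on_add:
  assumes "rat_poly_on V c S f" "rat_poly_on V c S f'"
  shows "rat_poly_on V c S (\<lambda>s. f s + f' s)"
proof -
  obtain p q where pq: "qpoly_vars p \<subseteq> V" "qpoly_vars q \<subseteq> V"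
    and eq: "\<And>s. s \<in> S \<Longrightarrow> f s = qpoly_eval (c s) p" "\<And>s. s \<in> S \<Longrightarrow> f' s = qpoly_eval (c s) q"
    using assms unfolding rat_poly_on_def by blast
  have "qpoly_vars (p + q) \<subseteq> V" using keys_add[of p q] pq unfolding qpoly_vars_def by blast
  with eq show ?thesis unfolding rat_poly_on_def by (auto simp: qpoly_eval_add)
qed

lemma rat_poly_on_sum:
  assumes "\<And>i. i \<in> I \<Longrightarrow> rat_poly_on V c S (f i)"
  shows "rat_poly_on V c S (\<lambda>s. \<Sum>i\<in>I. f i s)"
  using assms
proof (induction I rule: infinite_finite_induct)
  case (insert i I)
  then show ?case using rat_poly_on_add[of V c S "f i" "\<lambda>s. \<Sum>i\<in>I. f i s"] by simp
qed (use rat_poly_on_const[of V c S 0] in simp_all)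

text \<open>Distributivity expands the product into a double sum of single terms, so closure under
  sums suffices and no product of polynomials has to be evaluated.\<close>

lemma rat_poly_on_mult:
  assumes "rat_poly_on V c S f" "rat_poly_on V c S f'"
  shows "rat_poly_on V c S (\<lambda>s. f s * f' s)"
proof -
  obtain p q where pq: "qpoly_vars p \<subseteq> V" "qpoly_vars q \<subseteq> V"
    and eq: "\<And>s. s \<in> S \<Longrightarrow> f s = qpoly_eval (c s) p" "\<And>s. s \<in> S \<Longrightarrow> f' s = qpoly_eval (c s) q"
    using assms unfolding rat_poly_on_def by blast
  let ?t = "\<lambda>m m' s. of_rat (Poly_Mapping.lookup p m * Poly_Mapping.lookup q m') * monomial_eval (c s) (m + m')"
  have "rat_poly_on V c S (\<lambda>s. \<Sum>m\<in>Poly_Mapping.keys p. \<Sum>m'\<in>Poly_Mapping.keys q. ?t m m' s)"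
  proof (intro rat_poly_on_sum rat_poly_on_term)
    fix m m' assume "m \<in> Poly_Mapping.keys p" "m' \<in> Poly_Mapping.keys q"
    then show "Poly_Mapping.keys (m + m') \<subseteq> V"
      using keys_add[of m m'] pq unfolding qpoly_vars_def by blast
  qed
  then show ?thesis
  proof (rule rat_poly_on_cong)
    fix s assume "s \<in> S"
    then show "f s * f' s = (\<Sum>m\<in>Poly_Mapping.keys p. \<Sum>m'\<in>Poly_Mapping.keys q. ?t m m' s)"
      unfolding eq[OF \<open>s \<in> S\<close>] qpoly_eval_def monomial_eval_def[symmetric] sum_product
      by (simp add: of_rat_mult monomial_eval_add mult_ac)
  qed
qed

lemma rat_poly_on_prod:
  assumes "\<And>i. i \<in> I \<Longrightarrow> rat_poly_on V c S (f i)"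
  shows "rat_poly_on V c S (\<lambda>s. \<Prod>i\<in>I. f i s)"
  using assms
proof (induction I rule: infinite_finite_induct)
  case (insert i I)
  then show ?case using rat_poly_on_mult[of V c S "f i" "\<lambda>s. \<Prod>i\<in>I. f i s"] by simp
qed (use rat_poly_on_const[of V c S 1] in simp_all)

lemma rat_poly_on_det:
  assumes A: "\<And>s. s \<in> S \<Longrightarrow> A s \<in> carrier_mat n n"
    and "\<And>i j. i < n \<Longrightarrow> j < n \<Longrightarrow> rat_poly_on V c S (\<lambda>s. A s $$ (i, j))"
  shows "rat_poly_on V c S (\<lambda>s. det (A s))"
proof (rule rat_poly_on_cong)
  \<comment> \<open>The Leibniz formula, with the sign written through \<open>of_rat\<close> so that
    it is visibly a rational constant.\<close>
  show "rat_poly_on V c S (\<lambda>s. \<Sum>p\<in>{p. p permutes {0..<n}}.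
      of_rat (of_int (sign p)) * (\<Prod>i=0..<n. A s $$ (i, p i)))"
    by (intro rat_poly_on_sum rat_poly_on_mult rat_poly_on_prod rat_poly_on_const assms)
      (auto dest: permutes_in_image)
  show "det (A s) = (\<Sum>p\<in>{p. p permutes {0..<n}}.
      of_rat (of_int (sign p)) * (\<Prod>i=0..<n. A s $$ (i, p i)))" if "s \<in> S" for s
    unfolding det_def'[OF A[OF that]] by (simp add: of_rat_of_int_eq)
qed

lemma rat_poly_on_adj_mat:
  assumes A: "\<And>s. s \<in> S \<Longrightarrow> A s \<in> carrier_mat n n"
    and entries: "\<And>i j. i < n \<Longrightarrow> j < n \<Longrightarrow> rat_poly_on V c S (\<lambda>s. A s $$ (i, j))"
    and ij: "i < n" "j < n"
  shows "rat_poly_on V c S (\<lambda>s. adj_mat (A s) $$ (i, j))"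
proof (rule rat_poly_on_cong)
  \<comment> \<open>The adjugate is the transpose of the cofactor matrix, so its entry
    \<open>(i, j)\<close> deletes row \<open>j\<close> and column \<open>i\<close>.\<close>
  show "rat_poly_on V c S (\<lambda>s. of_rat ((-1) ^ (j + i)) * det (mat_delete (A s) j i))"
  proof (intro rat_poly_on_mult rat_poly_on_const rat_poly_on_det)
    show "mat_delete (A s) j i \<in> carrier_mat (n - 1) (n - 1)" if "s \<in> S" for s
      by (rule mat_delete_carrier[OF A[OF that]])
    fix k l assume kl: "k < n - 1" "l < n - 1"
    \<comment> \<open>Deletion shifts the later indices by one, so each entry of the minor is an
      entry of \<open>A s\<close>.\<close>
    have "rat_poly_on V c S (\<lambda>s. A s $$ (if k < j then k else Suc k, if l < i then l else Suc l))"
      by (rule entries) (use kl in auto)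
    then show "rat_poly_on V c S (\<lambda>s. mat_delete (A s) j i $$ (k, l))"
    proof (rule rat_poly_on_cong)
      fix s assume "s \<in> S"
      then have "dim_row (A s) = n" "dim_col (A s) = n" using A by auto
      then show "mat_delete (A s) j i $$ (k, l) =
          A s $$ (if k < j then k else Suc k, if l < i then l else Suc l)"
        using kl by (simp add: mat_delete_def)
    qed
  qed
  show "adj_mat (A s) $$ (i, j) = of_rat ((-1) ^ (j + i)) * det (mat_delete (A s) j i)"
    if "s \<in> S" for s
    using A[OF that] ij by (simp add: adj_mat_def cofactor_def of_rat_power of_rat_minus)
qed


section \<open>Invertible matrices with a prescribed zero pattern\<close>

lemma Units_ring_mat:
  "A \<in> Units (ring_mat TYPE('a::comm_ring_1) n ()) \<longleftrightarrow>
    A \<in> carrier_mat n n \<and> (\<exists>B\<in>carrier_mat n n. B * A = 1\<^sub>m n \<and> A * B = 1\<^sub>m n)"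
  by (simp add: Units_def ring_mat_simps)

lemma GL_simps:
  "carrier (GL n) = Units (ring_mat TYPE(complex) n ())" "A \<otimes>\<^bsub>GL n\<^esub> B = A * B" "\<one>\<^bsub>GL n\<^esub> = 1\<^sub>m n"
  by (simp_all add: GL_def units_of_def ring_mat_simps)

lemma group_GL: "group (GL n)"
proof -
  interpret ring "ring_mat TYPE(complex) n ()" by (rule ring_mat)
  show ?thesis unfolding GL_def by (rule units_group)
qed

lemma GL_inv:
  assumes "A \<in> carrier (GL n)"
  shows "inv\<^bsub>GL n\<^esub> A \<in> carrier (GL n)" "A * inv\<^bsub>GL n\<^esub> A = 1\<^sub>m n" "inv\<^bsub>GL n\<^esub> A * A = 1\<^sub>m n"
  using group.inv_closed[OF group_GL assms] group.r_inv[OF group_GL assms] group.l_inv[OF group_GL assms]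
  by (simp_all add: GL_simps)

lemma GL_carrier_mat: "A \<in> carrier (GL n) \<Longrightarrow> A \<in> carrier_mat n n"
  by (simp add: GL_simps Units_ring_mat)

lemma index_mult_mat_sum:
  "A \<in> carrier_mat n n \<Longrightarrow> B \<in> carrier_mat n n \<Longrightarrow> i < n \<Longrightarrow> j < n \<Longrightarrow>
    (A * B) $$ (i, j) = (\<Sum>k<n. A $$ (i, k) * B $$ (k, j))"
  by (auto simp: scalar_prod_def lessThan_atLeast0)

definition pattern :: "nat \<Rightarrow> (nat \<Rightarrow> nat \<Rightarrow> bool) \<Rightarrow> 'c::zero mat \<Rightarrow> bool" where
  "pattern n r A \<longleftrightarrow> (\<forall>i<n. \<forall>j<n. A $$ (i, j) \<noteq> 0 \<longrightarrow> r i j)"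

lemma pattern_mult:
  assumes "transp_on {..<n} r" "A \<in> carrier_mat n n" "B \<in> carrier_mat n n" "pattern n r A" "pattern n r B"
  shows "pattern n r (A * B :: 'c::semiring_0 mat)"
  unfolding pattern_def
proof (intro allI impI)
  fix i j assume ij: "i < n" "j < n" "(A * B) $$ (i, j) \<noteq> 0"
  then have "(\<Sum>k<n. A $$ (i, k) * B $$ (k, j)) \<noteq> 0" using index_mult_mat_sum[OF assms(2,3)] by simp
  then obtain k where k: "k < n" "A $$ (i, k) * B $$ (k, j) \<noteq> 0"
    by (meson lessThan_iff sum.not_neutral_contains_not_neutral)
  then have "A $$ (i, k) \<noteq> 0" "B $$ (k, j) \<noteq> 0" by auto
  with k(1) have "k < n" "r i k" "r k j" using assms(4,5) ij by (auto simp: pattern_def)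
  then show "r i j" using transp_onD[OF assms(1), of i k j] ij by simp
qed

text \<open>For a column \<open>j\<close> let \<open>S\<close> be the set of all \<open>i\<close> with \<open>r i j\<close>. Then \<open>A\<close> maps the vectors
  supported on \<open>S\<close> to themselves; as the \<open>S\<close>-block of the inverse is a left inverse of the
  \<open>S\<close>-block of \<open>A\<close>, it is also a right inverse.\<close>

lemma pattern_inverse:
  fixes A B :: "'c::field mat"
  assumes r: "transp_on {..<n} r" "reflp_on {..<n} r"
    and A: "A \<in> carrier_mat n n" "pattern n r A"
    and B: "B \<in> carrier_mat n n" "B * A = 1\<^sub>m n"
  shows "pattern n r B"
  unfolding pattern_def
proof (intro allI impI, rule ccontr)
  fix i j assume ij: "i < n" "j < n" and Bij: "B $$ (i, j) \<noteq> 0" and nr: "\<not> r i j"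
  have BA: "(\<Sum>k<n. B $$ (i, k) * A $$ (k, l)) = (if i = l then 1 else 0)" if "i < n" "l < n" for i l
    using index_mult_mat_sum[OF B(1) A(1) that] B(2) that by simp
  have jj: "r j j" using reflp_onD[OF r(2)] ij by simp
  \<comment> \<open>The S-block is padded by the identity to full size, so that the theorem on
    one-sided inverses of square matrices applies without renumbering S.\<close>
  define blk :: "'c mat \<Rightarrow> 'c mat" where
    "blk M = mat n n (\<lambda>(k, l). if r l j then (if r k j then M $$ (k, l) else 0) else (if k = l then 1 else 0))" for M
  have blk: "blk M \<in> carrier_mat n n" for M by (simp add: blk_def)
  have A0: "A $$ (k, l) = 0" if "k < n" "l < n" "r l j" "\<not> r k j" for k l
    using A(2) transp_onD[OF r(1), of k l j] that ij by (auto simp: pattern_def)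
  have "blk B * blk A = 1\<^sub>m n"
  proof (rule eq_matI)
    fix k l assume "k < dim_row (1\<^sub>m n :: 'c mat)" "l < dim_col (1\<^sub>m n :: 'c mat)"
    then have kl: "k < n" "l < n" by simp_all
    have "(blk B * blk A) $$ (k, l) = (\<Sum>u<n. blk B $$ (k, u) * blk A $$ (u, l))"
      by (rule index_mult_mat_sum[OF blk blk kl])
    also have "\<dots> = (if k = l then 1 else 0)"
    proof (cases "r l j")
      case True
      have "(\<Sum>u<n. blk B $$ (k, u) * blk A $$ (u, l))
          = (\<Sum>u<n. if r k j then B $$ (k, u) * A $$ (u, l) else 0)"
        by (rule sum.cong) (use True kl A0 in \<open>auto simp: blk_def\<close>)
      then show ?thesis using BA[OF kl] True by (cases "r k j") auto
    next
      case False
      have "(\<Sum>u<n. blk B $$ (k, u) * blk A $$ (u, l)) = (\<Sum>u<n. if u = l then blk B $$ (k, u) else 0)"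
        by (rule sum.cong) (use False kl in \<open>auto simp: blk_def\<close>)
      then show ?thesis using kl False by (simp add: blk_def)
    qed
    finally show "(blk B * blk A) $$ (k, l) = 1\<^sub>m n $$ (k, l)" using kl by simp
  qed (simp_all add: blk_def)
  then have "blk A * blk B = 1\<^sub>m n" by (rule mat_mult_left_right_inverse[OF blk blk])
  then have AB: "(\<Sum>u<n. blk A $$ (k, u) * blk B $$ (u, j)) = (if k = j then 1 else 0)" if "k < n" for k
    using index_mult_mat_sum[OF blk blk that ij(2), of A B] that ij by simp
  \<comment> \<open>\<open>?b\<close> is column \<open>j\<close> of \<open>B\<close> cut down to S.
    It satisfies \<open>A b = e_j\<close>; applying \<open>B\<close> gives \<open>b = B e_j\<close>,
    so column \<open>j\<close> of \<open>B\<close> is itself zero outside S.\<close>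
  let ?b = "\<lambda>u. if r u j then B $$ (u, j) else 0"
  have Ab: "(\<Sum>u<n. A $$ (k, u) * ?b u) = (if k = j then 1 else 0)" if k: "k < n" for k
  proof -
    have "(\<Sum>u<n. A $$ (k, u) * ?b u) = (\<Sum>u<n. blk A $$ (k, u) * blk B $$ (u, j))"
      by (rule sum.cong) (use k ij jj A0 in \<open>auto simp: blk_def\<close>)
    then show ?thesis using AB[OF k] by simp
  qed
  have "B $$ (i, j) = (\<Sum>k<n. B $$ (i, k) * (if k = j then 1 else 0))"
    using ij by (simp add: if_distrib[of "\<lambda>t. _ * t"] cong: if_cong)
  also have "\<dots> = (\<Sum>k<n. B $$ (i, k) * (\<Sum>u<n. A $$ (k, u) * ?b u))"
    by (rule sum.cong) (simp_all add: Ab)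
  also have "\<dots> = (\<Sum>u<n. (\<Sum>k<n. B $$ (i, k) * A $$ (k, u)) * ?b u)"
    by (simp only: sum_distrib_left sum_distrib_right mult.assoc) (rule sum.swap)
  also have "\<dots> = (\<Sum>u<n. (if i = u then 1 else 0) * ?b u)"
    by (rule sum.cong) (simp_all add: BA ij)
  also have "\<dots> = ?b i" using ij by (simp add: if_distrib[of "\<lambda>t. t * _"] if_distribR cong: if_cong)
  finally show False using nr Bij by simp
qed

definition pattern_group :: "nat \<Rightarrow> (nat \<Rightarrow> nat \<Rightarrow> bool) \<Rightarrow> complex mat set" where
  "pattern_group n r = {A \<in> carrier (GL n). pattern n r A}"

lemma pattern_one: "reflp_on {..<n} r \<Longrightarrow> pattern n r (1\<^sub>m n :: 'c::zero_neq_one mat)"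
  by (auto simp: pattern_def reflp_on_def)

lemma subgroup_pattern_group:
  assumes "transp_on {..<n} r" "reflp_on {..<n} r"
  shows "subgroup (pattern_group n r) (GL n)"
proof -
  interpret group "GL n" by (rule group_GL)
  show ?thesis
  proof (rule subgroupI)
    show "pattern_group n r \<subseteq> carrier (GL n)" by (auto simp: pattern_group_def)
    have "1\<^sub>m n \<in> pattern_group n r"
      using one_closed pattern_one[OF assms(2)] by (simp add: pattern_group_def GL_simps(3))
    then show "pattern_group n r \<noteq> {}" by blast
    show "inv\<^bsub>GL n\<^esub> A \<in> pattern_group n r" if "A \<in> pattern_group n r" for A
      using that GL_inv[of A n] pattern_inverse[OF assms, of A "inv\<^bsub>GL n\<^esub> A"] GL_carrier_mat
      by (simp add: pattern_group_def)
    show "A \<otimes>\<^bsub>GL n\<^esub> B \<in> pattern_group n r" if "A \<in> pattern_group n r" "B \<in> pattern_group n r" for A B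
      using that m_closed[of A B] pattern_mult[OF assms(1), of A B] GL_carrier_mat
      by (simp add: pattern_group_def GL_simps(2))
  qed
qed

lemma Q_morphism_alt: "Q_morphism V c S n f \<longleftrightarrow> (\<forall>k\<in>coords n. rat_poly_on V c S (\<lambda>s. mat_coord (f s) k))"
  by (simp add: Q_morphism_def rat_poly_on_def)

lemma coords_Some: "i < n \<Longrightarrow> j < n \<Longrightarrow> Some (i, j) \<in> coords n"
  by (simp add: coords_def)

lemma coords_cases:
  assumes "k \<in> coords n"
  obtains "k = None" | i j where "k = Some (i, j)" "i < n" "j < n"
  using assms by (auto simp: coords_def)

lemma Q_morphism_mult:
  assumes "H \<subseteq> carrier (GL n)"
  shows "Q_morphism (coords n <+> coords n) (\<lambda>(A, B). case_sum (mat_coord A) (mat_coord B))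
    (H \<times> H) n (\<lambda>(A, B). A \<otimes>\<^bsub>GL n\<^esub> B)"
  unfolding Q_morphism_alt
proof
  let ?V = "coords n <+> coords n"
  let ?c = "\<lambda>(A, B). case_sum (mat_coord A) (mat_coord B)"
  let ?P = "rat_poly_on ?V ?c (H \<times> H)"
  have left: "?P (\<lambda>s. mat_coord (fst s) k)" and right: "?P (\<lambda>s. mat_coord (snd s) k)"
    if "k \<in> coords n" for k
    using rat_poly_on_var[of "Inl k" ?V ?c "H \<times> H"] rat_poly_on_var[of "Inr k" ?V ?c "H \<times> H"] that
    by (auto simp: case_prod_beta)
  have H: "A \<in> carrier_mat n n" if "A \<in> H" for A using GL_carrier_mat assms that by blast
  fix k assume k: "k \<in> coords n"
  show "?P (\<lambda>s. mat_coord ((\<lambda>(A, B). A \<otimes>\<^bsub>GL n\<^esub> B) s) k)"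
    using k
  proof (cases rule: coords_cases)
    case 1
    have "?P (\<lambda>s. mat_coord (fst s) None * mat_coord (snd s) None)"
      by (intro rat_poly_on_mult left right) (simp_all add: coords_def)
    then show ?thesis
      by (rule rat_poly_on_cong) (auto simp: 1 GL_simps det_mult[OF H H])
  next
    case (2 i j)
    have "?P (\<lambda>s. \<Sum>l<n. mat_coord (fst s) (Some (i, l)) * mat_coord (snd s) (Some (l, j)))"
      by (intro rat_poly_on_sum rat_poly_on_mult left right coords_Some) (use 2 in auto)
    then show ?thesis
      by (rule rat_poly_on_cong) (auto simp: 2 GL_simps index_mult_mat_sum[OF H H 2(2,3)] simp del: index_mult_mat)
  qed
qed

text \<open>Cramer's rule, obtained by multiplying the adjugate identity from the left by the
  inverse of \<open>A\<close>.\<close>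

lemma GL_inv_adj_mat:
  assumes "A \<in> carrier (GL n)"
  shows "det A \<noteq> 0" "inv\<^bsub>GL n\<^esub> A = (1 / det A) \<cdot>\<^sub>m adj_mat A" "det (inv\<^bsub>GL n\<^esub> A) = 1 / det A"
proof -
  note A = GL_carrier_mat[OF assms]
  note I = GL_inv[OF assms]
  note IA = GL_carrier_mat[OF I(1)]
  have d: "det A * det (inv\<^bsub>GL n\<^esub> A) = 1" using det_mult[OF A IA] I(2) by simp
  then show d0: "det A \<noteq> 0" by auto
  then show "det (inv\<^bsub>GL n\<^esub> A) = 1 / det A" using d by (simp add: field_simps)
  have "inv\<^bsub>GL n\<^esub> A * (A * adj_mat A) = inv\<^bsub>GL n\<^esub> A * A * adj_mat A"
    using A IA adj_mat(1)[OF A] by (simp add: assoc_mult_mat)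
  then have "det A \<cdot>\<^sub>m inv\<^bsub>GL n\<^esub> A = adj_mat A"
    using adj_mat[OF A] I(3) IA by (simp add: mult_smult_distrib[OF IA one_carrier_mat])
  then have "(1 / det A) \<cdot>\<^sub>m (det A \<cdot>\<^sub>m inv\<^bsub>GL n\<^esub> A) = (1 / det A) \<cdot>\<^sub>m adj_mat A" by simp
  moreover have "(1 / det A) \<cdot>\<^sub>m (det A \<cdot>\<^sub>m inv\<^bsub>GL n\<^esub> A) = inv\<^bsub>GL n\<^esub> A"
    using d0 by (intro eq_matI) auto
  ultimately show "inv\<^bsub>GL n\<^esub> A = (1 / det A) \<cdot>\<^sub>m adj_mat A" by simp
qed

lemma Q_morphism_inv:
  assumes "H \<subseteq> carrier (GL n)"
  shows "Q_morphism (coords n) mat_coord H n (\<lambda>A. inv\<^bsub>GL n\<^esub> A)"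
  unfolding Q_morphism_alt
proof
  let ?P = "rat_poly_on (coords n) mat_coord H"
  have GL: "A \<in> carrier (GL n)" if "A \<in> H" for A using assms that by blast
  note H = GL_carrier_mat[OF GL]
  have entries: "?P (\<lambda>A. A $$ (i, j))" if "i < n" "j < n" for i j
    using rat_poly_on_var[OF coords_Some[OF that], of mat_coord H] by simp
  fix k assume k: "k \<in> coords n"
  show "?P (\<lambda>A. mat_coord (inv\<^bsub>GL n\<^esub> A) k)"
    using k
  proof (cases rule: coords_cases)
    case 1
    have "?P det" by (rule rat_poly_on_det[where A = "\<lambda>A. A", OF H entries])
    then show ?thesis by (rule rat_poly_on_cong) (simp add: 1 GL_inv_adj_mat(3)[OF GL])
  next
    case (2 i j)
    \<comment> \<open>The factor \<open>1 / det A\<close> in Cramer's rule is itself the coordinate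
      \<open>None\<close>, which makes inversion polynomial.\<close>
    have "?P (\<lambda>A. mat_coord A None * adj_mat A $$ (i, j))"
      by (intro rat_poly_on_mult rat_poly_on_var rat_poly_on_adj_mat[of _ _ n])
        (use H entries 2 in \<open>auto simp: coords_def\<close>)
    then show ?thesis
    proof (rule rat_poly_on_cong)
      fix A assume A: "A \<in> H"
      show "mat_coord (inv\<^bsub>GL n\<^esub> A) k = mat_coord A None * adj_mat A $$ (i, j)"
        using adj_mat(1)[OF H[OF A]] 2 by (simp add: GL_inv_adj_mat(2)[OF GL[OF A]])
    qed
  qed
qed

lemma Q_defined_pattern_group:
  assumes "transp_on {..<n} r" "reflp_on {..<n} r"
  shows "Q_defined_group n (pattern_group n r)"
proof -
  \<comment> \<open>The polynomial that is the single variable \<open>ij\<close>; the pattern is cut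
    out by one linear equation per forbidden entry.\<close>
  let ?p = "\<lambda>ij. Poly_Mapping.single (Poly_Mapping.single ij 1) 1 :: (nat \<times> nat) qpoly"
  let ?P = "?p ` {(i, j). i < n \<and> j < n \<and> \<not> r i j}"
  have "\<forall>p\<in>?P. qpoly_vars p \<subseteq> {..<n} \<times> {..<n}"
    by (auto simp: qpoly_vars_def)
  moreover have "qpoly_eval a (?p ij) = a ij" for a ij
    by (simp add: qpoly_eval_single monomial_eval_def)
  then have "pattern_group n r = {A \<in> carrier (GL n). \<forall>p\<in>?P. qpoly_eval (\<lambda>ij. A $$ ij) p = 0}"
    by (auto simp: pattern_group_def pattern_def)
  moreover have "pattern_group n r \<subseteq> carrier (GL n)" by (auto simp: pattern_group_def)
  ultimately show ?thesis
    unfolding Q_defined_group_def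
    using subgroup_pattern_group[OF assms] Q_morphism_mult Q_morphism_inv by blast
qed


section \<open>Integral points\<close>

text \<open>The target ring is general because both the complex and the rational numbers occur, in
  \<open>GL_int_subset\<close> and \<open>GL_int_subset_GL_rat\<close>.\<close>

lemma map_of_int_Units:
  assumes "A \<in> Units (ring_mat TYPE(int) n ())"
  shows "map_mat of_int A \<in> Units (ring_mat TYPE('c::comm_ring_1) n ())"
proof -
  obtain B where A: "A \<in> carrier_mat n n" and B: "B \<in> carrier_mat n n" "B * A = 1\<^sub>m n" "A * B = 1\<^sub>m n"
    using assms by (auto simp: Units_ring_mat)
  have "map_mat of_int B * map_mat of_int A = (1\<^sub>m n :: 'c mat)"
    "map_mat of_int A * map_mat of_int B = (1\<^sub>m n :: 'c mat)"
    using of_int_hom.mat_hom_mult[OF B(1) A, symmetric] of_int_hom.mat_hom_mult[OF A B(1), symmetric] B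
    by (simp_all add: of_int_hom.mat_hom_one)
  then show ?thesis unfolding Units_ring_mat using A B(1) by (intro conjI bexI[of _ "map_mat of_int B"]) auto
qed

lemma GL_int_subset: "GL_int n \<subseteq> carrier (GL n)"
  using map_of_int_Units by (auto simp: GL_int_def GL_simps)

lemma GL_int_subset_GL_rat: "GL_int n \<subseteq> GL_rat n"
proof
  fix A assume "A \<in> GL_int n"
  then obtain C where C: "C \<in> Units (ring_mat TYPE(int) n ())" "A = map_mat of_int C"
    by (auto simp: GL_int_def)
  have "A = map_mat of_rat (map_mat of_int C)" using C(2) by (intro eq_matI) auto
  then show "A \<in> GL_rat n" unfolding GL_rat_def using map_of_int_Units[OF C(1)] by blast
qed

lemma subgroup_GL_int: "subgroup (GL_int n) (GL n)"
proof -
  interpret group "GL n" by (rule group_GL)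
  interpret I: ring "ring_mat TYPE(int) n ()" by (rule ring_mat)
  have hom: "map_mat of_int (A * B) = (map_mat of_int A * map_mat of_int B :: complex mat)"
    if "A \<in> Units (ring_mat TYPE(int) n ())" "B \<in> Units (ring_mat TYPE(int) n ())" for A B
    using that of_int_hom.mat_hom_mult[of A n n B n] by (simp add: Units_ring_mat)
  show ?thesis
  proof (rule subgroupI[OF GL_int_subset])
    show "GL_int n \<noteq> {}" using I.Units_one_closed by (auto simp: GL_int_def)
    show "A \<otimes>\<^bsub>GL n\<^esub> B \<in> GL_int n" if "A \<in> GL_int n" "B \<in> GL_int n" for A B
    proof -
      obtain C D where CD: "C \<in> Units (ring_mat TYPE(int) n ())" "D \<in> Units (ring_mat TYPE(int) n ())"
        "A = map_mat of_int C" "B = map_mat of_int D" using \<open>A \<in> GL_int n\<close> \<open>B \<in> GL_int n\<close> by (auto simp: GL_int_def)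
      have "C * D \<in> Units (ring_mat TYPE(int) n ())" using I.Units_m_closed[OF CD(1,2)] by (simp add: ring_mat_simps)
      then show ?thesis using hom[OF CD(1,2)] CD(3,4) by (auto simp: GL_int_def GL_simps(2) intro!: image_eqI)
    qed
    show "inv\<^bsub>GL n\<^esub> A \<in> GL_int n" if "A \<in> GL_int n" for A
    proof -
      obtain C where C: "C \<in> Units (ring_mat TYPE(int) n ())" "A = map_mat of_int C"
        using \<open>A \<in> GL_int n\<close> by (auto simp: GL_int_def)
      then obtain D where D: "D \<in> Units (ring_mat TYPE(int) n ())" "D * C = 1\<^sub>m n"
        unfolding Units_ring_mat by blast
      have "map_mat of_int D \<otimes>\<^bsub>GL n\<^esub> A = \<one>\<^bsub>GL n\<^esub>"
        using hom[OF D(1) C(1)] D(2) C(2) by (simp add: GL_simps of_int_hom.mat_hom_one)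
      then have "inv\<^bsub>GL n\<^esub> A = map_mat of_int D"
        using C D map_of_int_Units by (intro inv_equality) (auto simp: GL_simps)
      then show ?thesis using D(1) by (auto simp: GL_int_def)
    qed
  qed
qed

lemma commensurable_refl:
  assumes "group K" "subgroup A K"
  shows "commensurable K A A"
proof -
  interpret A: group "K\<lparr>carrier := A\<rparr>" by (rule subgroup.subgroup_is_group[OF assms(2,1)])
  have "finite (rcosets\<^bsub>K\<lparr>carrier := A\<rparr>\<^esub> A)"
  proof (rule finite_subset)
    show "rcosets\<^bsub>K\<lparr>carrier := A\<rparr>\<^esub> A \<subseteq> {A}"
      using A.coset_join2[OF _ A.subgroup_self] by (auto simp: RCOSETS_def)
  qed simp
  then show ?thesis using assms by (simp add: commensurable_def finite_index_def)
qed

text \<open>The subgroup is the group of integral points itself, so commensurability holds with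
  index 1.\<close>

lemma arithmetic_subgroup_integral_points:
  assumes "subgroup H (GL n)"
  shows "arithmetic_subgroup n H (H \<inter> GL_int n)"
proof -
  have "subgroup (H \<inter> GL_int n) (GL n)"
    by (rule group.subgroups_Inter_pair[OF group_GL assms subgroup_GL_int])
  then show ?thesis
    unfolding arithmetic_subgroup_def using GL_int_subset_GL_rat commensurable_refl[OF group_GL] by blast
qed

section \<open>The stabiliser as an arithmetic group\<close>

context pc_graph
begin

definition to_mat :: "(nat \<Rightarrow> 'a) \<Rightarrow> ('a \<Rightarrow> 'a \<Rightarrow> int) \<Rightarrow> int mat" where
  "to_mat e M = mat (card X) (card X) (\<lambda>(i, j). M (e i) (e j))"

lemma to_mat_carrier [simp]: "to_mat e M \<in> carrier_mat (card X) (card X)"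
  by (simp add: to_mat_def)

lemma to_mat_index [simp]: "i < card X \<Longrightarrow> j < card X \<Longrightarrow> to_mat e M $$ (i, j) = M (e i) (e j)"
  by (simp add: to_mat_def)

lemma to_mat_eq_iff:
  assumes "bij_betw e {..<card X} X"
  shows "to_mat e M = to_mat e N \<longleftrightarrow> mat_eq M N"
proof
  assume eq: "to_mat e M = to_mat e N"
  show "mat_eq M N"
  proof (rule mat_eqI)
    fix x y assume "x \<in> X" "y \<in> X"
    then obtain i j where "i < card X" "j < card X" "x = e i" "y = e j"
      using assms unfolding bij_betw_def by blast
    then show "M y x = N y x" using eq to_mat_index by metis
  qed
next
  assume "mat_eq M N"
  moreover have "e i \<in> X" if "i < card X" for i using assms that by (auto simp: bij_betw_def)
  ultimately show "to_mat e M = to_mat e N" by (intro eq_matI) (auto simp: to_mat_def mat_eq_def)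
qed

lemma to_mat_mat_times:
  assumes e: "bij_betw e {..<card X} X"
  shows "to_mat e (mat_times M N) = to_mat e M * to_mat e N"
proof (rule eq_matI)
  fix i j assume "i < dim_row (to_mat e M * to_mat e N)" "j < dim_col (to_mat e M * to_mat e N)"
  then have ij: "i < card X" "j < card X" by (simp_all add: to_mat_def)
  have "(to_mat e M * to_mat e N) $$ (i, j) = (\<Sum>k<card X. M (e i) (e k) * N (e k) (e j))"
    using ij by (subst index_mult_mat_sum) (auto simp del: index_mult_mat)
  also have "\<dots> = mat_times M N (e i) (e j)"
    unfolding mat_times_def by (rule sum.reindex_bij_betw[OF e])
  finally show "to_mat e (mat_times M N) $$ (i, j) = (to_mat e M * to_mat e N) $$ (i, j)"
    using ij by simp
qed (simp_all add: to_mat_def)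

lemma to_mat_mat_one:
  assumes "bij_betw e {..<card X} X"
  shows "to_mat e mat_one = 1\<^sub>m (card X)"
  using inj_on_eq_iff[OF bij_betw_imp_inj_on[OF assms]]
  by (intro eq_matI) (auto simp: to_mat_def mat_one_def)

theorem arithmetic_St: "arithmetic_group (Aut_pc \<Gamma>\<lparr>carrier := St \<Gamma>\<rparr>)"
proof -
  let ?n = "card X"
  obtain e where e: "bij_betw e {..<?n} X"
    using ex_bij_betw_nat_finite[OF finite_X] by (auto simp: lessThan_atLeast0)
  have eX: "e i \<in> X" if "i < ?n" for i using e that by (auto simp: bij_betw_def)
  define r where "r i j \<longleftrightarrow> e i \<in> cl1 (e j)" for i j
  have r: "transp_on {..<?n} r" "reflp_on {..<?n} r"
    using cl1_trans eX cl1_refl unfolding r_def transp_on_def reflp_on_def by blast+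
  let ?H = "pattern_group ?n r"
  let ?A = "?H \<inter> GL_int ?n"
  define F :: "('a word set \<Rightarrow> 'a word set) \<Rightarrow> complex mat"
    where "F \<phi> = map_mat of_int (to_mat e (coef \<phi>))" for \<phi>
  \<comment> \<open>\<open>of_int\<close> into the complex numbers is injective, so zero patterns
    can be read off on either side. One direction places the image of \<open>F\<close> in
    \<open>?H\<close>, the other brings matrices back.\<close>
  have pattern: "pattern ?n r (map_mat of_int (to_mat e M) :: complex mat) \<longleftrightarrow> supported M" for M
  proof
    assume p: "pattern ?n r (map_mat of_int (to_mat e M) :: complex mat)"
    show "supported M"
      unfolding supported_def
    proof (intro ballI impI)
      fix x y assume "x \<in> X" "y \<in> X" "M y x \<noteq> 0"
      moreover from this obtain i j where "i < ?n" "j < ?n" "x = e i" "y = e j"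
        using e unfolding bij_betw_def by blast
      ultimately show "y \<in> cl1 x" using p by (auto simp: pattern_def r_def to_mat_def)
    qed
  qed (use eX in \<open>auto simp: pattern_def r_def supported_def to_mat_def\<close>)
  have F_A: "F \<phi> \<in> ?A" if \<phi>: "\<phi> \<in> St \<Gamma>" for \<phi>
  proof -
    obtain N where "mat_eq (mat_times (coef \<phi>) N) mat_one" "mat_eq (mat_times N (coef \<phi>)) mat_one"
      using St_coef_inverse[OF \<phi>] by blast
    then have "to_mat e (coef \<phi>) * to_mat e N = 1\<^sub>m ?n" "to_mat e N * to_mat e (coef \<phi>) = 1\<^sub>m ?n"
      by (simp_all add: to_mat_mat_times[OF e, symmetric] to_mat_eq_iff[OF e] to_mat_mat_one[OF e, symmetric])
    then have "to_mat e (coef \<phi>) \<in> Units (ring_mat TYPE(int) ?n ())"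
      unfolding Units_ring_mat by (intro conjI bexI[of _ "to_mat e N"]) simp_all
    then have "F \<phi> \<in> GL_int ?n" by (simp add: F_def GL_int_def)
    moreover have "pattern ?n r (F \<phi>)"
      unfolding F_def pattern by (rule supported_coef[OF St_endos[OF \<phi>]])
    ultimately show ?thesis using GL_int_subset by (auto simp: pattern_group_def)
  qed
  have "F \<in> hom (Aut_pc \<Gamma>\<lparr>carrier := St \<Gamma>\<rparr>) (GL ?n\<lparr>carrier := ?A\<rparr>)"
  proof (rule homI)
    fix \<phi> \<psi>
    assume "\<phi> \<in> carrier (Aut_pc \<Gamma>\<lparr>carrier := St \<Gamma>\<rparr>)" "\<psi> \<in> carrier (Aut_pc \<Gamma>\<lparr>carrier := St \<Gamma>\<rparr>)"
    then have *: "\<phi> \<in> St \<Gamma>" "\<psi> \<in> St \<Gamma>" by simp_all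
    have "to_mat e (coef (comp \<phi> \<psi>)) = to_mat e (coef \<phi>) * to_mat e (coef \<psi>)"
      unfolding to_mat_mat_times[OF e, symmetric] to_mat_eq_iff[OF e]
      by (rule mat_eq_coef_comp[OF St_endos[OF *(1)] St_endos[OF *(2)]])
    then show "F (\<phi> \<otimes>\<^bsub>Aut_pc \<Gamma>\<lparr>carrier := St \<Gamma>\<rparr>\<^esub> \<psi>) = F \<phi> \<otimes>\<^bsub>GL ?n\<lparr>carrier := ?A\<rparr>\<^esub> F \<psi>"
      using of_int_hom.mat_hom_mult[OF to_mat_carrier to_mat_carrier]
      by (simp add: F_def St_mult[OF *] GL_simps(2))
  qed (use F_A in auto)
  moreover have "bij_betw F (St \<Gamma>) ?A"
    unfolding bij_betw_def
  proof (intro conjI inj_onI subset_antisym subsetI)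
    fix \<phi> \<psi> assume *: "\<phi> \<in> St \<Gamma>" "\<psi> \<in> St \<Gamma>" "F \<phi> = F \<psi>"
    then have "to_mat e (coef \<phi>) = to_mat e (coef \<psi>)"
      unfolding F_def by (rule_tac of_int_hom.mat_hom_inj)
    then show "\<phi> = \<psi>"
      using to_mat_eq_iff[OF e] endos_eqI[OF St_endos[OF *(1)] St_endos[OF *(2)]] by blast
  next
    fix B assume "B \<in> F ` St \<Gamma>"
    then show "B \<in> ?A" using F_A by blast
  next
    fix B assume B: "B \<in> ?A"
    then obtain C D where C: "C \<in> carrier_mat ?n ?n" "B = map_mat of_int C"
      and D: "D \<in> carrier_mat ?n ?n" "D * C = 1\<^sub>m ?n" "C * D = 1\<^sub>m ?n"
      by (auto simp: GL_int_def Units_ring_mat)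
    let ?e' = "inv_into {..<?n} e"
    have e': "?e' (e i) = i" if "i < ?n" for i
      using that bij_betw_inv_into_left[OF e] by simp
    \<comment> \<open>A section of \<open>to_mat\<close>: entries are looked up through the inverse
      numbering, and values outside \<open>X\<close> are invisible to \<open>mat_eq\<close>.\<close>
    define to_fun where "to_fun M y x = M $$ (?e' y, ?e' x)" for M :: "int mat" and x y
    have to_fun: "to_mat e (to_fun M) = M" if "M \<in> carrier_mat ?n ?n" for M
      using that e' by (intro eq_matI) (auto simp: to_mat_def to_fun_def)
    have inv: "mat_eq (mat_times (to_fun C) (to_fun D)) mat_one" "mat_eq (mat_times (to_fun D) (to_fun C)) mat_one"
      by (simp_all add: to_mat_eq_iff[OF e, symmetric] to_mat_mat_times[OF e] to_mat_mat_one[OF e] to_fun C D)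
    have pB: "pattern ?n r B" using B by (simp add: pattern_group_def)
    \<comment> \<open>\<open>GL_int\<close> supplies an integral inverse but says nothing about its
      zeros. The pattern is established over the complex numbers, where
      \<open>pattern_inverse\<close> applies, and carried back to the integers.\<close>
    have "pattern ?n r (map_mat of_int D :: complex mat)"
    proof (rule pattern_inverse[OF r _ pB])
      show "map_mat of_int D * B = 1\<^sub>m ?n"
        using of_int_hom.mat_hom_mult[OF D(1) C(1), symmetric] C(2) D(2)
        by (simp add: of_int_hom.mat_hom_one)
    qed (use C D in auto)
    then have supported: "supported (to_fun C)" "supported (to_fun D)"
      using pB unfolding pattern[symmetric] to_fun[OF C(1)] to_fun[OF D(1)] C(2) by simp_all
    have "endo_of (to_fun C) \<in> St \<Gamma>" by (rule endo_of_St[OF supported inv])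
    moreover have "F (endo_of (to_fun C)) = B"
      using endo_of(2)[OF supported(1)] unfolding F_def to_mat_eq_iff[OF e, symmetric] to_fun[OF C(1)] C(2)
      by simp
    ultimately show "B \<in> F ` St \<Gamma>" by blast
  qed
  ultimately have "F \<in> iso (Aut_pc \<Gamma>\<lparr>carrier := St \<Gamma>\<rparr>) (GL ?n\<lparr>carrier := ?A\<rparr>)"
    by (simp add: iso_def)
  then have "Aut_pc \<Gamma>\<lparr>carrier := St \<Gamma>\<rparr> \<cong> GL ?n\<lparr>carrier := ?A\<rparr>" by (rule is_isoI)
  moreover have "group (Aut_pc \<Gamma>\<lparr>carrier := St \<Gamma>\<rparr>)"
    by (rule subgroup.subgroup_is_group[OF subgroup_St Aut.group_axioms])
  ultimately show ?thesis
    unfolding arithmetic_group_def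
    using Q_defined_pattern_group[OF r] arithmetic_subgroup_integral_points[OF subgroup_pattern_group[OF r]]
    by blast
qed

end

theorem theorem2p4:
  fixes \<Gamma> :: "('a, 'b) pre_digraph"
  assumes "graph \<Gamma>"
  shows "arithmetic_group (Aut_pc \<Gamma>\<lparr>carrier := St \<Gamma>\<rparr>) \<and>
    generate (Aut_pc \<Gamma>) (J_auts \<Gamma> \<union> V_perp \<Gamma> \<union> Tr_perp \<Gamma>) = St \<Gamma>"
proof -
  interpret pc_graph \<Gamma> using assms by (rule pc_graph.intro)
  show ?thesis using arithmetic_St generate_St by blast
qed

end
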